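(* Let $(\Omega_i,\mu_i)$, $i=1,\dots,d$, be measure spaces, and for $S\subseteq\{1,\dots,d\}$ equip $\prod_{j\in S}\Omega_j$ with the product measure. (i) If $f_i\colon\prod_{j\neq i}\Omega_j\to[0,\infty)$ are measurable for $i=1,\dots,d$, then $$\int_{\prod_{j=1}^d\Omega_j}\prod_{i=1}^d f_i(x_1,\dots,\widehat{x}_i,\dots,x_d)\,d\mu_1(x_1)\cdots d\mu_d(x_d)\le\prod_{i=1}^d\|f_i\|_{L^{d-1}(\prod_{j\ne i}\Omega_j)}.$$ (ii) If $f\colon\prod_{j=1}^d\Omega_j\to[0,\infty)$ is measurable, $0<p\le1$, and $\theta_1,\dots,\theta_d>0$ with $\sum_i\theta_i=1$, then $$\|f\|_{L^p(\prod_{j=1}^d\Omega_j)}\le\prod_{i=1}^d\|f_i\|_{L^{p_i}(\prod_{j\ne i}\Omega_j)}^{\theta_i},$$ where $p_i$ is defined by $\frac1{d-1}\left(1-\frac1p\right)=\theta_i\left(1-\frac1{p_i}\right)$ and $f_i(x_1,\dots,\widehat{x}_i,\dots,x_d):=\int_{\Omega_i}f(x_1,\dots,x_d)\,d\mu_i(x_i)$ is the $i$-th marginal. In particular, for all $0<p\le1$, $\|f\|_{L^p(\prod_j\Omega_j)}\le\prod_{i=1}^d\|f_i\|_{L^{\frac{p(d-1)}{d-p}}(\prod_{j\ne i}\Omega_j)}^{1/d}$. (iii) If in (ii) $p<1$ and both sides of the inequality in (ii) are finite and non-zero, then equality holds in (ii) if and only if there exist measurable $E_j\subseteq\Omega_j$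 of positive finite measure ($j=1,\dots,d$) and $c>0$ such that $f(x_1,\dots,x_d)=c\prod_{j=1}^d1_{E_j}(x_j)$ for almost every $(x_1,\dots,x_d)$.
   Context: $\widehat{x}_i$ denotes omission of the variable $x_i$.
   Formalization: The measure spaces are assumed sigma-finite (and d at least 2); without sigma-finiteness the product measure is not unique and (ii) can fail, e.g. for the diagonal with Lebesgue times counting measure and p = 1. *)

theory Defs
  imports "HOL-Analysis.Analysis"
begin

text \<open>Real power of an extended non-negative real, for positive exponents:
  \<open>\<infinity> powr r = \<infinity>\<close>, and for finite \<open>a\<close> the usual real power.\<close>
definition epowr :: "ennreal \<Rightarrow> real \<Rightarrow> ennreal" where
  "epowr a r = (if a = \<infinity> then \<infinity> else ennreal (enn2real a powr r))"

definition Lp_norm :: "'a measure \<Rightarrow> real \<Rightarrow> ('a \<Rightarrow> ennreal) \<Rightarrow> ennreal" where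
  "Lp_norm M p g = epowr (\<integral>\<^sup>+ x. epowr (g x) p \<partial>M) (1 / p)"

definition marginal :: "(nat \<Rightarrow> 'a measure) \<Rightarrow> nat \<Rightarrow> ((nat \<Rightarrow> 'a) \<Rightarrow> real)
    \<Rightarrow> (nat \<Rightarrow> 'a) \<Rightarrow> ennreal" where
  "marginal M i f y = (\<integral>\<^sup>+ t. ennreal (f (y(i := t))) \<partial>(M i))"

end

theory Submission
  imports Defs
begin

text \<open>
  Writing \<open>q_i\<close> for the exponent \<open>p_i\<close> of the paper, one has
  \<open>f^p = (\<Prod>_i f_i^(q_i/(d-1)))^(1-p) \<cdot> \<Prod>_i (f f_i^(q_i-1))^(p \<theta>_i)\<close>. The weights add up to 1, and
  integrating \<open>f f_i^(q_i-1)\<close> in \<open>x_i\<close> first gives \<open>\<integral> f_i^q_i\<close>, so Hoelder's inequality together with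
  Loomis--Whitney for the first factor gives (ii).

  If equality holds in (ii), then it holds in Loomis--Whitney, which forces the support of
  \<open>\<Prod>_i f_i\<close> to be a box, and in Hoelder, which makes all \<open>f_i^(q_i-1)\<close> proportional to each other
  on the support of \<open>f\<close>, which is this box. Their common value does not depend on any single
  coordinate, hence is constant on the box, and then so is \<open>f\<close>.
\<close>

section \<open>Powers of extended non-negative reals\<close>

text \<open>The relation defining q_i says exactly that the powers of f_i in the factorization
  cancel: q_i (1-p)/(d-1) + (q_i-1) p \<theta>_i = 0. For p < 1 it forces 0 < q_i < 1, so
  f_i^(q_i-1) is a negative power and the identity can fail where a marginal is 0 or infinite. But f
  vanishes almost everywhere on the set where f_i does, and f_i is infinite only on a null set once
  the integral of f_i^q_i is finite; integrals that are 0 or infinite are treated separately. At p =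
  1 the Loomis--Whitney factor has weight 0, and Tonelli gives equality instead. The induction for
  Loomis--Whitney carries the equality case along, because the box for one function is found from
  the equality case one dimension lower. Supports and constancy are known almost everywhere only, so
  independence of a coordinate has to be exploited on slices at suitably chosen values.\<close>

lemma epowr_ennreal: "0 \<le> x \<Longrightarrow> epowr (ennreal x) r = ennreal (x powr r)"
  by (simp add: epowr_def)

lemma epowr_top [simp]: "epowr top r = top"
  by (simp add: epowr_def)

lemma epowr_0 [simp]: "epowr 0 r = 0"
  by (simp add: epowr_def)

lemma epowr_one [simp]: "epowr 1 r = 1"
  by (simp add: epowr_def)

lemma epowr_exp_1 [simp]: "epowr a 1 = a"
  by (cases a) (simp_all add: epowr_ennreal)

lemma epowr_eq_0_iff [simp]: "epowr a r = 0 \<longleftrightarrow> a = 0"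
  by (cases a) (simp_all add: epowr_ennreal)

lemma epowr_eq_top_iff [simp]: "epowr a r = top \<longleftrightarrow> a = top"
  by (cases a) (simp_all add: epowr_ennreal)

lemma epowr_less_top_iff [simp]: "epowr a r < top \<longleftrightarrow> a < top"
  by (metis epowr_eq_top_iff less_top)

text \<open>No sign condition on \<open>r\<close> is required: every power fixes 0 and
  \<open>top\<close>, which is consistent with \<open>0 * top = 0\<close>.\<close>

lemma epowr_mult: "epowr (a * b) r = epowr a r * epowr b r"
proof (cases "a = 0 \<or> b = 0 \<or> a = top \<or> b = top")
  case True
  then show ?thesis
    by (metis ennreal_mult_eq_top_iff epowr_0 epowr_eq_0_iff epowr_top mult_zero_left mult_zero_right)
next
  case False
  then show ?thesis
    by (cases a; cases b) (auto simp: epowr_ennreal powr_mult simp flip: ennreal_mult)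
qed

lemma epowr_prod: "epowr (\<Prod>i\<in>I. g i) r = (\<Prod>i\<in>I. epowr (g i) r)"
  by (induction I rule: infinite_finite_induct) (simp_all add: epowr_mult)

lemma epowr_epowr [simp]: "epowr (epowr a r) s = epowr a (r * s)"
  by (cases a) (simp_all add: epowr_ennreal powr_powr)

lemma epowr_add: "epowr a (r + s) = epowr a r * epowr a s"
  by (cases a) (simp_all add: epowr_ennreal powr_add ennreal_mult)

text \<open>Nonemptiness matters because \<open>epowr a 0\<close> is not 1 but \<open>a\<close>
  itself for \<open>a = 0\<close> and \<open>a = top\<close>.\<close>

lemma epowr_sum:
  assumes "finite I" "I \<noteq> {}"
  shows "epowr a (\<Sum>i\<in>I. r i) = (\<Prod>i\<in>I. epowr a (r i))"
  using assms by (induction rule: finite_ne_induct) (simp_all add: epowr_add)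

lemma epowr_mono:
  assumes "a \<le> b" "0 \<le> r"
  shows "epowr a r \<le> epowr b r"
proof (cases "b = top")
  case False
  with assms show ?thesis
    by (cases a; cases b) (auto simp: epowr_ennreal top_unique intro!: powr_mono2)
qed simp

lemma epowr_inject: "r \<noteq> 0 \<Longrightarrow> epowr a r = epowr b r \<longleftrightarrow> a = b"
  by (metis epowr_epowr epowr_exp_1 right_inverse)

lemma measurable_epowr [measurable (raw)]:
  assumes [measurable]: "g \<in> borel_measurable M"
  shows "(\<lambda>x. epowr (g x) r) \<in> borel_measurable M"
  unfolding epowr_def by measurable

section \<open>Hoelder's inequality for finitely many functions\<close>

text \<open>Normalize by the mean \<open>S\<close> and use \<open>ln t \<le> t - 1\<close>: the
  weighted mean of \<open>v i / S\<close> is 1, so the weighted sum \<open>L\<close> of the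
  logarithms is at most 0, and the geometric mean is \<open>S * exp L\<close>. The same argument
  gives the equality case, since \<open>ln t = t - 1\<close> only for \<open>t = 1\<close>.\<close>

lemma amgm_weighted:
  fixes v a :: "'i \<Rightarrow> real"
  assumes fin: "finite I" and a: "\<And>i. i \<in> I \<Longrightarrow> 0 < a i" "(\<Sum>i\<in>I. a i) = 1"
    and v: "\<And>i. i \<in> I \<Longrightarrow> 0 \<le> v i"
  shows amgm_weighted_le: "(\<Prod>i\<in>I. v i powr a i) \<le> (\<Sum>i\<in>I. a i * v i)"
    and amgm_weighted_eqD: "\<lbrakk>(\<Prod>i\<in>I. v i powr a i) = (\<Sum>i\<in>I. a i * v i); j \<in> I\<rbrakk>
      \<Longrightarrow> v j = (\<Sum>i\<in>I. a i * v i)"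
proof -
  define S where "S = (\<Sum>i\<in>I. a i * v i)"
  have S0: "0 \<le> S"
    unfolding S_def using a v by (intro sum_nonneg) (simp add: less_imp_le)
  have "(\<Prod>i\<in>I. v i powr a i) \<le> S \<and> ((\<Prod>i\<in>I. v i powr a i) = S \<longrightarrow> (\<forall>i\<in>I. v i = S))"
  proof (cases "S = 0")
    case True
    then have "\<forall>i\<in>I. a i * v i = 0"
      unfolding S_def using a v fin by (subst (asm) sum_nonneg_eq_0_iff) (auto simp: less_imp_le)
    then have 0: "\<forall>i\<in>I. v i = 0"
      using a by force
    have "I \<noteq> {}" using a by auto
    with 0 fin have prod: "(\<Prod>i\<in>I. v i powr a i) = 0"
      by (auto simp: prod_zero_iff)
    show ?thesis unfolding prod True using 0 by simp
  next
    case False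
    with S0 have S: "S > 0" by simp
    show ?thesis
    proof (cases "\<exists>i\<in>I. v i = 0")
      case True
      then have "(\<Prod>i\<in>I. v i powr a i) = 0"
        using fin by (auto simp: prod_zero_iff)
      with S show ?thesis by auto
    next
      case False
      with v have vp: "v i > 0" if "i \<in> I" for i
        using that by (metis less_eq_real_def)
      define L where "L = (\<Sum>i\<in>I. a i * ln (v i / S))"
      have gap: "a i * (v i / S - 1 - ln (v i / S)) \<ge> 0" if "i \<in> I" for i
        using that a vp S ln_le_minus_one[of "v i / S"] by (intro mult_nonneg_nonneg) (auto simp: less_imp_le)
      have "(\<Sum>i\<in>I. a i * (v i / S - 1)) = 0"
        using S a(2) by (simp add: right_diff_distrib sum_subtractf S_def flip: sum_divide_distrib)
      then have L: "(\<Sum>i\<in>I. a i * (v i / S - 1 - ln (v i / S))) = - L"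
        by (simp add: L_def right_diff_distrib sum_subtractf)
      then have "L \<le> 0"
        using sum_nonneg[of I "\<lambda>i. a i * (v i / S - 1 - ln (v i / S))"] gap by simp
      have "(\<Prod>i\<in>I. v i powr a i) = (\<Prod>i\<in>I. S powr a i * exp (a i * ln (v i / S)))"
      proof (intro prod.cong refl)
        fix i assume "i \<in> I"
        then show "v i powr a i = S powr a i * exp (a i * ln (v i / S))"
          using vp[of i] S by (simp add: powr_def ln_div right_diff_distrib flip: exp_add)
      qed
      also have "\<dots> = S powr (\<Sum>i\<in>I. a i) * exp L"
        using S fin by (simp add: prod.distrib powr_sum exp_sum L_def)
      finally have P: "(\<Prod>i\<in>I. v i powr a i) = S * exp L"
        using a S by simp
      have "\<forall>i\<in>I. v i = S" if "S * exp L = S"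
      proof -
        have "L = 0" using that S by simp
        then have "(\<Sum>i\<in>I. a i * (v i / S - 1 - ln (v i / S))) = 0"
          using L by simp
        then have "\<forall>i\<in>I. a i * (v i / S - 1 - ln (v i / S)) = 0"
          using gap fin sum_nonneg_eq_0_iff[of I "\<lambda>i. a i * (v i / S - 1 - ln (v i / S))"] by blast
        then have ln: "ln (v i / S) = v i / S - 1" if "i \<in> I" for i
          using a that by force
        have "v i / S = 1" if "i \<in> I" for i
          by (rule ln_eq_minus_one) (use vp[OF that] S ln[OF that] in simp_all)
        then show ?thesis using S by auto
      qed
      moreover have "S * exp L \<le> S" using \<open>L \<le> 0\<close> S by simp
      ultimately show ?thesis using P by simp
    qed
  qed
  then show "(\<Prod>i\<in>I. v i powr a i) \<le> (\<Sum>i\<in>I. a i * v i)"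
    and "\<lbrakk>(\<Prod>i\<in>I. v i powr a i) = (\<Sum>i\<in>I. a i * v i); j \<in> I\<rbrakk> \<Longrightarrow> v j = (\<Sum>i\<in>I. a i * v i)"
    unfolding S_def by blast+
qed

lemma amgm_weighted_ennreal:
  fixes v :: "'i \<Rightarrow> ennreal" and a :: "'i \<Rightarrow> real"
  assumes fin: "finite I" and a: "\<And>i. i \<in> I \<Longrightarrow> 0 < a i" "(\<Sum>i\<in>I. a i) = 1"
  shows amgm_weighted_ennreal_le: "(\<Prod>i\<in>I. epowr (v i) (a i)) \<le> (\<Sum>i\<in>I. ennreal (a i) * v i)"
    and amgm_weighted_ennreal_eqD:
      "\<lbrakk>(\<Prod>i\<in>I. epowr (v i) (a i)) = (\<Sum>i\<in>I. ennreal (a i) * v i);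
        (\<Sum>i\<in>I. ennreal (a i) * v i) < top; j \<in> I\<rbrakk> \<Longrightarrow> v j = (\<Sum>i\<in>I. ennreal (a i) * v i)"
proof -
  \<comment> \<open>Positive weights turn finiteness of the mean into finiteness of every
    \<open>v i\<close>, which permits the passage to reals.\<close>
  have top: "\<forall>i\<in>I. v i < top" if "(\<Sum>i\<in>I. ennreal (a i) * v i) < top"
  proof
    fix i assume i: "i \<in> I"
    have "ennreal (a i) * v i \<le> (\<Sum>i\<in>I. ennreal (a i) * v i)"
      using fin i by (intro member_le_sum) auto
    then have "ennreal (a i) * v i < top"
      using that by (rule le_less_trans)
    then show "v i < top"
      using a(1)[OF i] by (auto simp: ennreal_mult_less_top)
  qed
  have eqs: "(\<Prod>i\<in>I. epowr (v i) (a i)) = ennreal (\<Prod>i\<in>I. enn2real (v i) powr a i)"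
    "(\<Sum>i\<in>I. ennreal (a i) * v i) = ennreal (\<Sum>i\<in>I. a i * enn2real (v i))"
    if "\<forall>i\<in>I. v i < top"
  proof -
    have v: "v i = ennreal (enn2real (v i))" if "i \<in> I" for i
      using \<open>\<forall>i\<in>I. v i < top\<close> that by simp
    have "(\<Prod>i\<in>I. epowr (v i) (a i)) = (\<Prod>i\<in>I. ennreal (enn2real (v i) powr a i))"
    proof (intro prod.cong refl)
      fix i assume "i \<in> I"
      then show "epowr (v i) (a i) = ennreal (enn2real (v i) powr a i)"
        using that by (auto simp: epowr_def)
    qed
    then show "(\<Prod>i\<in>I. epowr (v i) (a i)) = ennreal (\<Prod>i\<in>I. enn2real (v i) powr a i)"
      by (simp add: prod_ennreal)
    have "(\<Sum>i\<in>I. ennreal (a i) * v i) = (\<Sum>i\<in>I. ennreal (a i * enn2real (v i)))"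
      using a v by (intro sum.cong) (auto simp: ennreal_mult less_imp_le)
    then show "(\<Sum>i\<in>I. ennreal (a i) * v i) = ennreal (\<Sum>i\<in>I. a i * enn2real (v i))"
      using a by (simp add: sum_ennreal less_imp_le)
  qed
  have nn: "0 \<le> (\<Sum>i\<in>I. a i * enn2real (v i))"
    using a by (intro sum_nonneg) (simp add: less_imp_le)
  show "(\<Prod>i\<in>I. epowr (v i) (a i)) \<le> (\<Sum>i\<in>I. ennreal (a i) * v i)"
  proof (cases "(\<Sum>i\<in>I. ennreal (a i) * v i) < top")
    case True
    show ?thesis
      using amgm_weighted_le[of I a "\<lambda>i. enn2real (v i)"] fin a eqs[OF top[OF True]]
      by (simp add: ennreal_leI)
  qed (simp flip: less_top)
  show "v j = (\<Sum>i\<in>I. ennreal (a i) * v i)"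
    if eq: "(\<Prod>i\<in>I. epowr (v i) (a i)) = (\<Sum>i\<in>I. ennreal (a i) * v i)"
      and f: "(\<Sum>i\<in>I. ennreal (a i) * v i) < top" and j: "j \<in> I"
  proof -
    have "(\<Prod>i\<in>I. enn2real (v i) powr a i) = (\<Sum>i\<in>I. a i * enn2real (v i))"
    proof (subst ennreal_inj[symmetric])
      show "ennreal (\<Prod>i\<in>I. enn2real (v i) powr a i) = ennreal (\<Sum>i\<in>I. a i * enn2real (v i))"
        using eq eqs[OF top[OF f]] by metis
    qed (use nn in \<open>auto intro: prod_nonneg\<close>)
    then have "enn2real (v j) = (\<Sum>i\<in>I. a i * enn2real (v i))"
      by (intro amgm_weighted_eqD[OF fin a _ _ j]) simp_all
    then have "ennreal (enn2real (v j)) = (\<Sum>i\<in>I. ennreal (a i) * v i)"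
      unfolding eqs(2)[OF top[OF f]] by (rule arg_cong)
    then show ?thesis
      using top[OF f] j by (metis ennreal_enn2real)
  qed
qed

lemma nn_integral_eq_imp_AE_eq:
  assumes [measurable]: "u \<in> borel_measurable M" "v \<in> borel_measurable M"
    and le: "\<And>x. u x \<le> v x" and eq: "(\<integral>\<^sup>+x. u x \<partial>M) = (\<integral>\<^sup>+x. v x \<partial>M)"
    and fin: "(\<integral>\<^sup>+x. v x \<partial>M) < top"
  shows "AE x in M. u x = v x"
proof -
  have "(\<integral>\<^sup>+x. v x - u x \<partial>M) = (\<integral>\<^sup>+x. v x \<partial>M) - (\<integral>\<^sup>+x. u x \<partial>M)"
    using eq fin le by (intro nn_integral_diff) auto
  then have "(\<integral>\<^sup>+x. v x - u x \<partial>M) = 0"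
    using eq fin by simp
  then have "AE x in M. v x - u x = 0"
    by (subst (asm) nn_integral_0_iff_AE) auto
  then show ?thesis
    by eventually_elim (metis antisym le ennreal_minus_eq_0)
qed

text \<open>AM-GM is applied pointwise to the functions \<open>u i\<close> divided by their
  integrals; the weighted sum of these quotients integrates to 1. Equality after integration forces
  equality in AM-GM almost everywhere, hence equal quotients.\<close>

theorem nn_integral_Holder:
  assumes fin: "finite I" and a: "\<And>i. i \<in> I \<Longrightarrow> 0 < a i" "(\<Sum>i\<in>I. a i) = 1"
    and u [measurable]: "\<And>i. i \<in> I \<Longrightarrow> u i \<in> borel_measurable M"
  shows nn_integral_Holder_le:
    "(\<integral>\<^sup>+x. (\<Prod>i\<in>I. epowr (u i x) (a i)) \<partial>M) \<le> (\<Prod>i\<in>I. epowr (\<integral>\<^sup>+x. u i x \<partial>M) (a i))"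
    and nn_integral_Holder_eqD:
    "\<lbrakk>(\<integral>\<^sup>+x. (\<Prod>i\<in>I. epowr (u i x) (a i)) \<partial>M) = (\<Prod>i\<in>I. epowr (\<integral>\<^sup>+x. u i x \<partial>M) (a i));
      \<And>i. i \<in> I \<Longrightarrow> 0 < (\<integral>\<^sup>+x. u i x \<partial>M); \<And>i. i \<in> I \<Longrightarrow> (\<integral>\<^sup>+x. u i x \<partial>M) < top\<rbrakk>
      \<Longrightarrow> AE x in M. \<forall>i\<in>I. \<forall>j\<in>I. u i x / (\<integral>\<^sup>+x. u i x \<partial>M) = u j x / (\<integral>\<^sup>+x. u j x \<partial>M)"
proof -
  define U where "U i = (\<integral>\<^sup>+x. u i x \<partial>M)" for i
  define v where "v i x = u i x / U i" for i x
  have v [measurable]: "v i \<in> borel_measurable M" if "i \<in> I" for i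
    using u[OF that] unfolding v_def by measurable
  let ?G = "\<lambda>x. \<Prod>i\<in>I. epowr (v i x) (a i)"
  let ?A = "\<lambda>x. \<Sum>i\<in>I. ennreal (a i) * v i x"
  have regular: "(\<integral>\<^sup>+x. (\<Prod>i\<in>I. epowr (u i x) (a i)) \<partial>M) = (\<Prod>i\<in>I. epowr (U i) (a i)) * (\<integral>\<^sup>+x. ?G x \<partial>M)"
    "(\<integral>\<^sup>+x. ?A x \<partial>M) = 1"
    if U: "\<forall>i\<in>I. 0 < U i \<and> U i < top"
  proof -
    have uv: "u i x = U i * v i x" if "i \<in> I" for i x
    proof -
      have "U i \<noteq> 0" "U i \<noteq> top"
        using U that by auto
      then show ?thesis
        by (simp add: v_def ennreal_times_divide mult.commute[of "U i"] ennreal_mult_divide_eq)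
    qed
    have "(\<integral>\<^sup>+x. (\<Prod>i\<in>I. epowr (u i x) (a i)) \<partial>M) = (\<integral>\<^sup>+x. (\<Prod>i\<in>I. epowr (U i) (a i)) * ?G x \<partial>M)"
      by (intro nn_integral_cong) (simp add: uv epowr_mult prod.distrib)
    then show "(\<integral>\<^sup>+x. (\<Prod>i\<in>I. epowr (u i x) (a i)) \<partial>M) = (\<Prod>i\<in>I. epowr (U i) (a i)) * (\<integral>\<^sup>+x. ?G x \<partial>M)"
      by (simp add: nn_integral_cmult)
    have "(\<integral>\<^sup>+x. v i x \<partial>M) = 1" if "i \<in> I" for i
      unfolding v_def using U that
      by (subst nn_integral_divide) (auto simp: ennreal_divide_self simp flip: U_def)
    then have "(\<integral>\<^sup>+x. ?A x \<partial>M) = (\<Sum>i\<in>I. ennreal (a i))"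
      by (simp add: nn_integral_sum nn_integral_cmult)
    then show "(\<integral>\<^sup>+x. ?A x \<partial>M) = 1"
      using a by (simp add: sum_ennreal less_imp_le)
  qed
  have GA: "?G x \<le> ?A x" for x
    using fin a by (intro amgm_weighted_ennreal_le) auto
  show "(\<integral>\<^sup>+x. (\<Prod>i\<in>I. epowr (u i x) (a i)) \<partial>M) \<le> (\<Prod>i\<in>I. epowr (\<integral>\<^sup>+x. u i x \<partial>M) (a i))"
    unfolding U_def[symmetric]
  proof (cases "\<exists>i\<in>I. U i = 0")
    \<comment> \<open>Zero integrals come before infinite ones: a zero factor makes the right-hand
      side 0 even if another factor is \<open>top\<close>.\<close>
    case True
    then obtain i where i: "i \<in> I" "U i = 0" by auto
    then have "AE x in M. u i x = 0"
      unfolding U_def using u[OF i(1)] by (subst (asm) nn_integral_0_iff_AE) auto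
    then have "AE x in M. (\<Prod>i\<in>I. epowr (u i x) (a i)) = 0"
      by eventually_elim (use i fin in auto)
    then have "(\<integral>\<^sup>+x. (\<Prod>i\<in>I. epowr (u i x) (a i)) \<partial>M) = 0"
      by (subst nn_integral_0_iff_AE) auto
    then show "(\<integral>\<^sup>+x. (\<Prod>i\<in>I. epowr (u i x) (a i)) \<partial>M) \<le> (\<Prod>i\<in>I. epowr (U i) (a i))" by simp
  next
    case pos: False
    show "(\<integral>\<^sup>+x. (\<Prod>i\<in>I. epowr (u i x) (a i)) \<partial>M) \<le> (\<Prod>i\<in>I. epowr (U i) (a i))"
    proof (cases "\<exists>i\<in>I. U i = top")
      case True
      then have "(\<Prod>i\<in>I. epowr (U i) (a i)) = top"
        using pos fin by (auto simp: ennreal_prod_eq_top)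
      then show ?thesis by simp
    next
      case False
      have U: "\<forall>i\<in>I. 0 < U i \<and> U i < top"
        using pos False by (metis not_gr_zero less_top)
      have "(\<integral>\<^sup>+x. ?G x \<partial>M) \<le> 1"
        using nn_integral_mono[of M ?G ?A] GA regular(2)[OF U] by simp
      then show ?thesis
        using mult_left_mono[of _ 1 "\<Prod>i\<in>I. epowr (U i) (a i)"] regular(1)[OF U] by simp
    qed
  qed
  assume eq: "(\<integral>\<^sup>+x. (\<Prod>i\<in>I. epowr (u i x) (a i)) \<partial>M) = (\<Prod>i\<in>I. epowr (\<integral>\<^sup>+x. u i x \<partial>M) (a i))"
    and pos: "\<And>i. i \<in> I \<Longrightarrow> 0 < (\<integral>\<^sup>+x. u i x \<partial>M)" and top: "\<And>i. i \<in> I \<Longrightarrow> (\<integral>\<^sup>+x. u i x \<partial>M) < top"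
  have U: "\<forall>i\<in>I. 0 < U i \<and> U i < top"
    using pos top by (simp add: U_def)
  let ?c = "\<Prod>i\<in>I. epowr (U i) (a i)"
  have c: "?c \<noteq> 0" "?c \<noteq> top"
    using U by (force simp: ennreal_prod_eq_top)+
  have "?c * (\<integral>\<^sup>+x. ?G x \<partial>M) = ?c * 1"
    using eq regular(1)[OF U] by (simp add: U_def)
  then have "(\<integral>\<^sup>+x. ?G x \<partial>M) = 1"
    using c by (subst (asm) ennreal_mult_cancel_left) auto
  then have "AE x in M. ?G x = ?A x"
    using regular(2)[OF U] GA by (intro nn_integral_eq_imp_AE_eq) auto
  moreover have "AE x in M. ?A x \<noteq> top"
    using nn_integral_PInf_AE[of ?A M] regular(2)[OF U] by simp
  ultimately have "AE x in M. \<forall>i\<in>I. \<forall>j\<in>I. v i x = v j x"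
  proof eventually_elim
    case (elim x)
    have "v i x = ?A x" if "i \<in> I" for i
      by (rule amgm_weighted_ennreal_eqD[OF fin a _ _ that]) (use elim in \<open>auto simp flip: less_top\<close>)
    then show ?case by simp
  qed
  then show "AE x in M. \<forall>i\<in>I. \<forall>j\<in>I. u i x / (\<integral>\<^sup>+x. u i x \<partial>M) = u j x / (\<integral>\<^sup>+x. u j x \<partial>M)"
    by (simp add: v_def U_def)
qed

text \<open>The distinguished factor of weight \<open>b\<close> gets the index \<open>None\<close>.
  Below it is \<open>H e\<close> next to the lower-dimensional product, and \<open>LW_prod\<close>
  next to the weighted copies of \<open>F\<close>.\<close>

lemma nn_integral_Holder_extra:
  fixes a :: "'i \<Rightarrow> real" and b :: real
  assumes fin: "finite I" and a: "\<And>i. i \<in> I \<Longrightarrow> 0 < a i" and b: "0 < b" and ab: "b + (\<Sum>i\<in>I. a i) = 1"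
    and v: "v \<in> borel_measurable M" and u: "\<And>i. i \<in> I \<Longrightarrow> u i \<in> borel_measurable M"
  shows nn_integral_Holder_extra_le: "(\<integral>\<^sup>+x. epowr (v x) b * (\<Prod>i\<in>I. epowr (u i x) (a i)) \<partial>M)
      \<le> epowr (\<integral>\<^sup>+x. v x \<partial>M) b * (\<Prod>i\<in>I. epowr (\<integral>\<^sup>+x. u i x \<partial>M) (a i))"
    and nn_integral_Holder_extra_eqD:
    "\<lbrakk>(\<integral>\<^sup>+x. epowr (v x) b * (\<Prod>i\<in>I. epowr (u i x) (a i)) \<partial>M)
        = epowr (\<integral>\<^sup>+x. v x \<partial>M) b * (\<Prod>i\<in>I. epowr (\<integral>\<^sup>+x. u i x \<partial>M) (a i));
      0 < (\<integral>\<^sup>+x. v x \<partial>M); (\<integral>\<^sup>+x. v x \<partial>M) < top;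
      \<And>i. i \<in> I \<Longrightarrow> 0 < (\<integral>\<^sup>+x. u i x \<partial>M); \<And>i. i \<in> I \<Longrightarrow> (\<integral>\<^sup>+x. u i x \<partial>M) < top\<rbrakk>
      \<Longrightarrow> AE x in M. \<forall>i\<in>I. u i x / (\<integral>\<^sup>+x. u i x \<partial>M) = v x / (\<integral>\<^sup>+x. v x \<partial>M)"
proof -
  let ?I = "insert None (Some ` I)"
  let ?a = "case_option b a" and ?u = "case_option v u"
  have U: "(\<Prod>i\<in>?I. epowr (?u i x) (?a i)) = epowr (v x) b * (\<Prod>i\<in>I. epowr (u i x) (a i))" for x
    using fin by (subst prod.insert) (auto simp: prod.reindex)
  have V: "(\<Prod>i\<in>?I. epowr (\<integral>\<^sup>+x. ?u i x \<partial>M) (?a i))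
      = epowr (\<integral>\<^sup>+x. v x \<partial>M) b * (\<Prod>i\<in>I. epowr (\<integral>\<^sup>+x. u i x \<partial>M) (a i))"
    using fin by (subst prod.insert) (auto simp: prod.reindex)
  have H: "finite ?I" "\<forall>i\<in>?I. 0 < ?a i" "\<forall>i\<in>?I. ?u i \<in> borel_measurable M"
    using fin a b u v by auto
  have s: "(\<Sum>i\<in>?I. ?a i) = 1"
    using fin ab by (subst sum.insert) (auto simp: sum.reindex)
  have "(\<integral>\<^sup>+x. (\<Prod>i\<in>?I. epowr (?u i x) (?a i)) \<partial>M) \<le> (\<Prod>i\<in>?I. epowr (\<integral>\<^sup>+x. ?u i x \<partial>M) (?a i))"
    by (rule nn_integral_Holder_le[OF H(1) _ s]) (use H in blast)+
  then show "(\<integral>\<^sup>+x. epowr (v x) b * (\<Prod>i\<in>I. epowr (u i x) (a i)) \<partial>M)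
      \<le> epowr (\<integral>\<^sup>+x. v x \<partial>M) b * (\<Prod>i\<in>I. epowr (\<integral>\<^sup>+x. u i x \<partial>M) (a i))"
    unfolding U V .
  assume eq: "(\<integral>\<^sup>+x. epowr (v x) b * (\<Prod>i\<in>I. epowr (u i x) (a i)) \<partial>M)
        = epowr (\<integral>\<^sup>+x. v x \<partial>M) b * (\<Prod>i\<in>I. epowr (\<integral>\<^sup>+x. u i x \<partial>M) (a i))"
    and pos: "0 < (\<integral>\<^sup>+x. v x \<partial>M)" "(\<integral>\<^sup>+x. v x \<partial>M) < top"
      "\<And>i. i \<in> I \<Longrightarrow> 0 < (\<integral>\<^sup>+x. u i x \<partial>M)" "\<And>i. i \<in> I \<Longrightarrow> (\<integral>\<^sup>+x. u i x \<partial>M) < top"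
  have P: "\<forall>i\<in>?I. 0 < (\<integral>\<^sup>+x. ?u i x \<partial>M) \<and> (\<integral>\<^sup>+x. ?u i x \<partial>M) < top"
    using pos by auto
  have "AE x in M. \<forall>i\<in>?I. \<forall>j\<in>?I. ?u i x / (\<integral>\<^sup>+x. ?u i x \<partial>M) = ?u j x / (\<integral>\<^sup>+x. ?u j x \<partial>M)"
    by (rule nn_integral_Holder_eqD[OF H(1) _ s, where M = M]) (use H P in \<open>blast | simp only: U V eq\<close>)+
  then show "AE x in M. \<forall>i\<in>I. u i x / (\<integral>\<^sup>+x. u i x \<partial>M) = v x / (\<integral>\<^sup>+x. v x \<partial>M)"
  proof eventually_elim
    case (elim x)
    show ?case
    proof
      fix i assume "i \<in> I"
      then have "Some i \<in> ?I" "None \<in> ?I" by auto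
      from elim[rule_format, OF this]
      show "u i x / (\<integral>\<^sup>+x. u i x \<partial>M) = v x / (\<integral>\<^sup>+x. v x \<partial>M)" by simp
    qed
  qed
qed

section \<open>The Loomis--Whitney inequality and its equality case\<close>

lemma restrict_fun_upd_Diff:
  assumes "y \<in> extensional (I - {e})"
  shows "restrict (y(e := t)) (I - {e}) = y"
  using assms by (auto simp: fun_eq_iff extensional_def)

lemma measurable_update_PiM:
  "\<lbrakk>e \<in> I; y \<in> space (PiM (I - {e}) M)\<rbrakk> \<Longrightarrow> (\<lambda>t. y(e := t)) \<in> M e \<rightarrow>\<^sub>M PiM I M"
  using measurable_component_update[of y "I - {e}" M e] by (simp add: insert_absorb)

context product_sigma_finite
begin

lemma nn_integral_PiM_remove:
  assumes "finite I" "e \<in> I" "f \<in> borel_measurable (PiM I M)"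
  shows "(\<integral>\<^sup>+x. f x \<partial>PiM I M) = (\<integral>\<^sup>+y. (\<integral>\<^sup>+t. f (y(e := t)) \<partial>M e) \<partial>PiM (I - {e}) M)"
  using product_nn_integral_insert[of "I - {e}" e f] assms by (simp add: insert_absorb)

lemma borel_measurable_nn_integral_update:
  assumes "e \<in> I" "f \<in> borel_measurable (PiM I M)"
  shows "(\<lambda>y. \<integral>\<^sup>+t. f (y(e := t)) \<partial>M e) \<in> borel_measurable (PiM (I - {e}) M)"
proof -
  have "(\<lambda>(y, t). y(e := t)) \<in> PiM (I - {e}) M \<Otimes>\<^sub>M M e \<rightarrow>\<^sub>M PiM I M"
    using measurable_add_dim[of e "I - {e}" M] assms(1) by (simp add: insert_absorb)
  from measurable_compose[OF this assms(2)]
  show ?thesis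
    by (intro M.borel_measurable_nn_integral) (simp add: case_prod_unfold)
qed

text \<open>By Tonelli the cylinder over a null set has measure 0 times that of the whole space of
  \<open>M e\<close>, which is 0 even if the latter is infinite.\<close>

lemma AE_PiM_restrict:
  assumes I: "finite I" "e \<in> I" and P: "AE y in PiM (I - {e}) M. P y"
  shows "AE x in PiM I M. P (restrict x (I - {e}))"
proof -
  from P obtain N where N: "{y \<in> space (PiM (I - {e}) M). \<not> P y} \<subseteq> N"
    "emeasure (PiM (I - {e}) M) N = 0" "N \<in> sets (PiM (I - {e}) M)"
    by (rule AE_E)
  note N(3)[measurable]
  have restr [measurable]: "(\<lambda>x. restrict x (I - {e})) \<in> PiM I M \<rightarrow>\<^sub>M PiM (I - {e}) M"
    by (rule measurable_restrict_subset) auto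
  have "(\<integral>\<^sup>+x. indicator N (restrict x (I - {e})) \<partial>PiM I M) =
      (\<integral>\<^sup>+y. (\<integral>\<^sup>+t. indicator N (restrict (y(e := t)) (I - {e})) \<partial>M e) \<partial>PiM (I - {e}) M)"
    using I by (intro nn_integral_PiM_remove) auto
  also have "\<dots> = (\<integral>\<^sup>+y. indicator N y * emeasure (M e) (space (M e)) \<partial>PiM (I - {e}) M)"
    by (intro nn_integral_cong) (simp add: restrict_fun_upd_Diff extensional_restrict space_PiM PiE_iff)
  also have "\<dots> = 0"
    using N(2) by (simp add: nn_integral_multc)
  finally have "AE x in PiM I M. indicator N (restrict x (I - {e})) = (0 :: ennreal)"
    by (subst (asm) nn_integral_0_iff_AE) auto
  with AE_space show ?thesis
  proof eventually_elim
    case (elim x)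
    then have "restrict x (I - {e}) \<in> space (PiM (I - {e}) M)"
      using measurable_space[OF restr] by blast
    with elim N(1) show ?case
      by (auto simp: indicator_eq_0_iff)
  qed
qed

text \<open>The condition for \<open>e\<close> leaves coordinate \<open>e\<close> free, so
  coordinate \<open>j\<close> is constrained by every \<open>E e j\<close> with
  \<open>e \<noteq> j\<close>; their intersection \<open>F j\<close> is the side of the common box.
  Having at least two indices makes this intersection nonempty as a family, hence
  measurable.\<close>

lemma AE_PiM_product_support:
  assumes I: "finite I" "card I \<ge> 2"
    and ex: "\<And>e. e \<in> I \<Longrightarrow> \<exists>E. (\<forall>j\<in>I - {e}. E j \<in> sets (M j)) \<and>
      (AE y in PiM (I - {e}) M. P e y \<longleftrightarrow> (\<forall>j\<in>I - {e}. y j \<in> E j))"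
  shows "\<exists>E. (\<forall>j\<in>I. E j \<in> sets (M j)) \<and>
      (AE x in PiM I M. (\<forall>e\<in>I. P e (restrict x (I - {e}))) \<longleftrightarrow> (\<forall>j\<in>I. x j \<in> E j))"
proof -
  have "\<forall>e\<in>I. \<exists>E. (\<forall>j\<in>I - {e}. E j \<in> sets (M j)) \<and>
      (AE y in PiM (I - {e}) M. P e y \<longleftrightarrow> (\<forall>j\<in>I - {e}. y j \<in> E j))"
    using ex by blast
  then obtain E where "\<forall>e\<in>I. (\<forall>j\<in>I - {e}. E e j \<in> sets (M j)) \<and>
      (AE y in PiM (I - {e}) M. P e y \<longleftrightarrow> (\<forall>j\<in>I - {e}. y j \<in> E e j))"
    by (rule bchoice[THEN exE])
  then have E: "\<And>e j. e \<in> I \<Longrightarrow> j \<in> I - {e} \<Longrightarrow> E e j \<in> sets (M j)"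
    "\<And>e. e \<in> I \<Longrightarrow> AE y in PiM (I - {e}) M. P e y \<longleftrightarrow> (\<forall>j\<in>I - {e}. y j \<in> E e j)"
    by blast+
  have ne: "I - {j} \<noteq> {}" for j
    using I(2) card_mono[of "{j}" I] by auto
  define F where "F j = (\<Inter>e\<in>I - {j}. E e j)" for j
  have "\<forall>j\<in>I. F j \<in> sets (M j)"
    unfolding F_def using I E(1) ne by (auto intro!: sets.finite_INT)
  moreover have "AE x in PiM I M. \<forall>e\<in>I. P e (restrict x (I - {e})) \<longleftrightarrow>
      (\<forall>j\<in>I - {e}. restrict x (I - {e}) j \<in> E e j)"
    using I(1) AE_PiM_restrict[OF I(1) _ E(2)] by (subst AE_ball_countable) (auto simp: countable_finite)
  then have "AE x in PiM I M. (\<forall>e\<in>I. P e (restrict x (I - {e}))) \<longleftrightarrow> (\<forall>j\<in>I. x j \<in> F j)"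
    by eventually_elim (auto simp: F_def)
  ultimately show ?thesis by blast
qed

text \<open>Here \<open>H i\<close> stands for the (d-1)-st power of the i-th function and
  \<open>Suc n\<close> for d-1. One coordinate is integrated out by Hoelder's inequality, and the
  partial integrals \<open>K i\<close> are handled by induction. The equality case records only
  supports: this is enough to keep the induction going and to find the box later.\<close>

lemma Loomis_Whitney_with_equality:
  assumes "finite I" "card I = Suc (Suc n)"
    and "\<And>i. i \<in> I \<Longrightarrow> H i \<in> borel_measurable (PiM (I - {i}) M)"
  shows "(\<integral>\<^sup>+x. (\<Prod>i\<in>I. epowr (H i (restrict x (I - {i}))) (1 / real (Suc n))) \<partial>PiM I M)
        \<le> (\<Prod>i\<in>I. epowr (\<integral>\<^sup>+y. H i y \<partial>PiM (I - {i}) M) (1 / real (Suc n))) \<and>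
    ((\<integral>\<^sup>+x. (\<Prod>i\<in>I. epowr (H i (restrict x (I - {i}))) (1 / real (Suc n))) \<partial>PiM I M)
        = (\<Prod>i\<in>I. epowr (\<integral>\<^sup>+y. H i y \<partial>PiM (I - {i}) M) (1 / real (Suc n))) \<longrightarrow>
      (\<forall>i\<in>I. 0 < (\<integral>\<^sup>+y. H i y \<partial>PiM (I - {i}) M) \<and> (\<integral>\<^sup>+y. H i y \<partial>PiM (I - {i}) M) < top) \<longrightarrow>
      (\<exists>E. (\<forall>j\<in>I. E j \<in> sets (M j)) \<and>
        (AE x in PiM I M. (\<forall>i\<in>I. H i (restrict x (I - {i})) \<noteq> 0) \<longleftrightarrow> (\<forall>j\<in>I. x j \<in> E j))))"
  using assms
proof (induction n arbitrary: I H)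
  case 0
  note I = \<open>finite I\<close> \<open>card I = Suc (Suc 0)\<close> and Hm = "0.prems"(3)
  have restr: "(\<lambda>x. restrict x (I - {i})) \<in> PiM I M \<rightarrow>\<^sub>M PiM (I - {i}) M" for i
    by (rule measurable_restrict_subset) auto
  obtain a b where ab: "I = {a, b}" "a \<noteq> b"
    using I by (metis card_2_iff numeral_2_eq_2)
  have Ia: "I - {a} = {b}" and Ib: "I - {b} = {a}"
    using ab by auto
  let ?u = "\<lambda>_. undefined"
  have [measurable]: "H a \<in> borel_measurable (PiM {b} M)" "H b \<in> borel_measurable (PiM {a} M)"
    using Hm[of a] Hm[of b] ab Ia Ib by auto
  have m: "(\<lambda>x. H a (restrict x {b}) * H b (restrict x {a})) \<in> borel_measurable (PiM I M)"
    using measurable_compose[OF restr Hm, of a] measurable_compose[OF restr Hm, of b] ab Ia Ib by simp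
  have b: "(\<integral>\<^sup>+y. H b y \<partial>PiM {a} M) = (\<integral>\<^sup>+t. H b (?u(a := t)) \<partial>M a)"
    using nn_integral_PiM_remove[of "{a}" a "H b"] by (simp add: nn_integral_empty)
  \<comment> \<open>In dimension 2 each function depends on one coordinate, so the integral
    factorizes and equality always holds.\<close>
  have "(\<integral>\<^sup>+x. H a (restrict x {b}) * H b (restrict x {a}) \<partial>PiM I M)
      = (\<integral>\<^sup>+y. (\<integral>\<^sup>+t. H a (restrict (y(a := t)) {b}) * H b (restrict (y(a := t)) {a}) \<partial>M a) \<partial>PiM {b} M)"
    using nn_integral_PiM_remove[OF I(1) _ m, of a] ab Ia by simp
  also have "\<dots> = (\<integral>\<^sup>+y. (\<integral>\<^sup>+t. H a y * H b (?u(a := t)) \<partial>M a) \<partial>PiM {b} M)"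
  proof (intro nn_integral_cong)
    fix y t assume "y \<in> space (PiM {b} M)"
    then have "restrict (y(a := t)) {b} = y" "restrict (y(a := t)) {a} = ?u(a := t)"
      using ab by (auto simp: space_PiM PiE_iff extensional_def fun_eq_iff)
    then show "H a (restrict (y(a := t)) {b}) * H b (restrict (y(a := t)) {a}) = H a y * H b (?u(a := t))"
      by simp
  qed
  also have "\<dots> = (\<integral>\<^sup>+y. H a y * (\<integral>\<^sup>+t. H b (?u(a := t)) \<partial>M a) \<partial>PiM {b} M)"
  proof -
    have [measurable]: "(\<lambda>t. H b (?u(a := t))) \<in> borel_measurable (M a)"
      by (rule measurable_compose[OF measurable_update_PiM[of a "{a}" ?u M]]) auto
    show ?thesis by (simp add: nn_integral_cmult)
  qed
  also have "\<dots> = (\<integral>\<^sup>+y. H a y \<partial>PiM {b} M) * (\<integral>\<^sup>+y. H b y \<partial>PiM {a} M)"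
    by (simp add: nn_integral_multc b)
  finally have eq: "(\<integral>\<^sup>+x. (\<Prod>i\<in>I. epowr (H i (restrict x (I - {i}))) (1 / real (Suc 0))) \<partial>PiM I M)
        = (\<Prod>i\<in>I. epowr (\<integral>\<^sup>+y. H i y \<partial>PiM (I - {i}) M) (1 / real (Suc 0)))"
    using ab Ia Ib by (simp del: insert_Diff_if)
  \<comment> \<open>A support in one dimension is already a box, with the support itself as its only
    side.\<close>
  have "\<exists>E. (\<forall>j\<in>I - {e}. E j \<in> sets (M j)) \<and>
      (AE y in PiM (I - {e}) M. H e y \<noteq> 0 \<longleftrightarrow> (\<forall>j\<in>I - {e}. y j \<in> E j))" if e: "e \<in> I" for e
  proof -
    obtain c where c: "I - {e} = {c}"
      using ab e by auto
    have [measurable]: "H e \<in> borel_measurable (PiM {c} M)"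
      using Hm[OF e] c by simp
    have [measurable]: "(\<lambda>t. H e (?u(c := t))) \<in> borel_measurable (M c)"
      by (rule measurable_compose[OF measurable_update_PiM[of c "{c}" ?u M]]) auto
    have "?u(c := y c) = y \<and> y c \<in> space (M c)" if "y \<in> space (PiM {c} M)" for y
      using that by (auto simp: space_PiM PiE_iff extensional_def fun_eq_iff)
    then show ?thesis
      unfolding c by (intro exI[of _ "\<lambda>_. {t \<in> space (M c). H e (?u(c := t)) \<noteq> 0}"]) auto
  qed
  then have "\<exists>E. (\<forall>j\<in>I. E j \<in> sets (M j)) \<and>
      (AE x in PiM I M. (\<forall>i\<in>I. H i (restrict x (I - {i})) \<noteq> 0) \<longleftrightarrow> (\<forall>j\<in>I. x j \<in> E j))"
    using I by (intro AE_PiM_product_support) auto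
  then show ?case
    unfolding eq by blast
next
  case (Suc n)
  note I = \<open>finite I\<close> \<open>card I = Suc (Suc (Suc n))\<close> and Hm = Suc.prems(3)
  \<comment> \<open>With d = \<open>card I\<close>, \<open>?a\<close> is 1/(d-1), and
    \<open>?b\<close> = (d-2)/(d-1) turns the exponent 1/(d-2) of the induction hypothesis into
    1/(d-1).\<close>
  let ?a = "1 / real (Suc (Suc n))" and ?b = "real (Suc n) / real (Suc (Suc n))"
  let ?L = "\<integral>\<^sup>+x. (\<Prod>i\<in>I. epowr (H i (restrict x (I - {i}))) ?a) \<partial>PiM I M"
  let ?R = "\<Prod>i\<in>I. epowr (\<integral>\<^sup>+y. H i y \<partial>PiM (I - {i}) M) ?a"
  have restr: "(\<lambda>x. restrict x (J - {i})) \<in> PiM J M \<rightarrow>\<^sub>M PiM (J - {i}) M" for i J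
    by (rule measurable_restrict_subset) auto
  have ab: "0 < ?a" "0 < ?b" "?a + ?b = 1"
    by (auto simp: field_simps)
  have step: "?L \<le> ?R \<and> (?L = ?R \<longrightarrow>
      (\<forall>i\<in>I. 0 < (\<integral>\<^sup>+y. H i y \<partial>PiM (I - {i}) M) \<and> (\<integral>\<^sup>+y. H i y \<partial>PiM (I - {i}) M) < top) \<longrightarrow>
      (\<exists>E. (\<forall>j\<in>I - {e}. E j \<in> sets (M j)) \<and>
        (AE y in PiM (I - {e}) M. H e y \<noteq> 0 \<longleftrightarrow> (\<forall>j\<in>I - {e}. y j \<in> E j))))"
    if e: "e \<in> I" for e
  proof -
    define J where "J = I - {e}"
    have J: "finite J" "card J = Suc (Suc n)" and IJ: "I = insert e J" "e \<notin> J"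
      using I e by (auto simp: J_def)
    have JI: "I - {i} - {e} = J - {i}" for i
      by (auto simp: J_def)
    define K where "K i y = (\<integral>\<^sup>+t. H i (y(e := t)) \<partial>M e)" for i y
    have Km: "K i \<in> borel_measurable (PiM (J - {i}) M)" if "i \<in> J" for i
      unfolding K_def JI[symmetric] using that IJ by (intro borel_measurable_nn_integral_update Hm) auto
    have KH: "(\<integral>\<^sup>+y. K i y \<partial>PiM (J - {i}) M) = (\<integral>\<^sup>+y. H i y \<partial>PiM (I - {i}) M)" if "i \<in> J" for i
      unfolding K_def JI[symmetric] using that IJ I
      by (intro nn_integral_PiM_remove[symmetric] Hm) auto
    have He [measurable]: "H e \<in> borel_measurable (PiM J M)"
      using Hm[OF e] by (simp add: J_def)
    define Q where "Q x = (\<Prod>i\<in>J. epowr (K i (restrict x (J - {i}))) (1 / real (Suc n)))" for x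
    have [measurable]: "(\<lambda>x. K i (restrict x (J - {i}))) \<in> borel_measurable (PiM J M)" if "i \<in> J" for i
      by (rule measurable_compose[OF restr Km[OF that]])
    have Qm [measurable]: "Q \<in> borel_measurable (PiM J M)"
      unfolding Q_def by measurable
    have "?L = (\<integral>\<^sup>+x. (\<integral>\<^sup>+t. (\<Prod>i\<in>I. epowr (H i (restrict (x(e := t)) (I - {i}))) ?a) \<partial>M e) \<partial>PiM J M)"
    proof -
      have [measurable]: "(\<lambda>x. H i (restrict x (I - {i}))) \<in> borel_measurable (PiM I M)" if "i \<in> I" for i
        by (rule measurable_compose[OF restr Hm[OF that]])
      show ?thesis
        unfolding J_def using I e by (intro nn_integral_PiM_remove) auto
    qed
    \<comment> \<open>Deleting coordinate \<open>e\<close> from \<open>x(e := t)\<close> leaves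
      \<open>x\<close>, so \<open>H e\<close> is constant in \<open>t\<close> and moves out. The
      other d-1 factors all have exponent \<open>?a\<close>, and these exponents add up to 1 as
      Hoelder's inequality in \<open>t\<close> demands.\<close>
    also have "\<dots> \<le> (\<integral>\<^sup>+x. epowr (H e x) ?a * epowr (Q x) ?b \<partial>PiM J M)"
    proof (rule nn_integral_mono)
      fix x assume x: "x \<in> space (PiM J M)"
      then have upd: "restrict (x(e := t)) J = x" "i \<in> J \<Longrightarrow> restrict (x(e := t)) (I - {i}) = (restrict x (J - {i}))(e := t)" for i t
        using IJ by (auto simp: space_PiM PiE_iff extensional_def fun_eq_iff)
      have [measurable]: "(\<lambda>t. H i ((restrict x (J - {i}))(e := t))) \<in> borel_measurable (M e)" if "i \<in> J" for i
      proof (rule measurable_compose[OF measurable_update_PiM Hm])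
        show "restrict x (J - {i}) \<in> space (PiM (I - {i} - {e}) M)"
          unfolding JI using measurable_space[OF restr x] .
      qed (use that IJ in auto)
      have "(\<integral>\<^sup>+t. (\<Prod>i\<in>I. epowr (H i (restrict (x(e := t)) (I - {i}))) ?a) \<partial>M e)
          = (\<integral>\<^sup>+t. epowr (H e x) ?a * (\<Prod>i\<in>J. epowr (H i ((restrict x (J - {i}))(e := t))) ?a) \<partial>M e)"
      proof (rule nn_integral_cong)
        fix t
        have "(\<Prod>i\<in>J. epowr (H i (restrict (x(e := t)) (I - {i}))) ?a)
            = (\<Prod>i\<in>J. epowr (H i ((restrict x (J - {i}))(e := t))) ?a)"
          by (rule prod.cong[OF refl]) (simp only: upd)
        then show "(\<Prod>i\<in>I. epowr (H i (restrict (x(e := t)) (I - {i}))) ?a)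
            = epowr (H e x) ?a * (\<Prod>i\<in>J. epowr (H i ((restrict x (J - {i}))(e := t))) ?a)"
          by (simp only: prod.remove[OF I(1) e] J_def[symmetric] upd(1))
      qed
      also have "\<dots> = epowr (H e x) ?a * (\<integral>\<^sup>+t. (\<Prod>i\<in>J. epowr (H i ((restrict x (J - {i}))(e := t))) ?a) \<partial>M e)"
        by (rule nn_integral_cmult) measurable
      also have "\<dots> \<le> epowr (H e x) ?a * (\<Prod>i\<in>J. epowr (K i (restrict x (J - {i}))) ?a)"
        unfolding K_def using J by (intro mult_left_mono nn_integral_Holder_le) auto
      also have "(\<Prod>i\<in>J. epowr (K i (restrict x (J - {i}))) ?a) = epowr (Q x) ?b"
        by (simp add: Q_def epowr_prod)
      finally show "(\<integral>\<^sup>+t. (\<Prod>i\<in>I. epowr (H i (restrict (x(e := t)) (I - {i}))) ?a) \<partial>M e)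
          \<le> epowr (H e x) ?a * epowr (Q x) ?b" .
    qed
    finally have L1: "?L \<le> (\<integral>\<^sup>+x. epowr (H e x) ?a * epowr (Q x) ?b \<partial>PiM J M)" .
    let ?He = "\<integral>\<^sup>+y. H e y \<partial>PiM J M" and ?Q = "\<integral>\<^sup>+x. Q x \<partial>PiM J M"
    let ?K = "\<Prod>i\<in>J. epowr (\<integral>\<^sup>+y. K i y \<partial>PiM (J - {i}) M) (1 / real (Suc n))"
    have L2: "(\<integral>\<^sup>+x. epowr (H e x) ?a * epowr (Q x) ?b \<partial>PiM J M) \<le> epowr ?He ?a * epowr ?Q ?b"
      using nn_integral_Holder_extra_le[of "{()}" "\<lambda>_. ?b" ?a "H e" "PiM J M" "\<lambda>_. Q"] ab by simp
    note IH = Suc.IH[of J K, OF J Km, folded Q_def]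
    have L3: "epowr ?He ?a * epowr ?Q ?b \<le> epowr ?He ?a * epowr ?K ?b"
      using IH by (intro mult_left_mono epowr_mono) auto
    have R: "epowr ?He ?a * epowr ?K ?b = ?R"
    proof -
      have "epowr ?K ?b = (\<Prod>i\<in>J. epowr (\<integral>\<^sup>+y. H i y \<partial>PiM (I - {i}) M) ?a)"
        unfolding epowr_prod by (intro prod.cong) (auto simp: KH)
      then show ?thesis
        using J IJ by (simp add: J_def[symmetric])
    qed
    \<comment> \<open>Equality in the Hoelder step with \<open>H e\<close> alone suffices: it identifies the support of \<open>H e\<close> with that
      of \<open>Q\<close>, a box by induction. Every \<open>e\<close> can play this role.\<close>
    have "\<exists>E. (\<forall>j\<in>J. E j \<in> sets (M j)) \<and> (AE y in PiM J M. H e y \<noteq> 0 \<longleftrightarrow> (\<forall>j\<in>J. y j \<in> E j))"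
      if eq: "?L = ?R" and fin: "\<forall>i\<in>I. 0 < (\<integral>\<^sup>+y. H i y \<partial>PiM (I - {i}) M) \<and> (\<integral>\<^sup>+y. H i y \<partial>PiM (I - {i}) M) < top"
    proof -
      have He: "0 < ?He" "?He < top"
        using fin e by (auto simp: J_def)
      have Kf: "\<forall>i\<in>J. 0 < (\<integral>\<^sup>+y. K i y \<partial>PiM (J - {i}) M) \<and> (\<integral>\<^sup>+y. K i y \<partial>PiM (J - {i}) M) < top"
        using fin IJ by (auto simp: KH)
      have "epowr ?He ?a * epowr ?Q ?b = epowr ?He ?a * epowr ?K ?b"
        and eq2: "(\<integral>\<^sup>+x. epowr (H e x) ?a * epowr (Q x) ?b \<partial>PiM J M) = epowr ?He ?a * epowr ?Q ?b"
        using L1 L2 L3 R eq by auto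
      then have "epowr ?Q ?b = epowr ?K ?b"
        using He by (subst (asm) ennreal_mult_cancel_left) auto
      then have QK: "?Q = ?K"
        using ab(2) by (subst (asm) epowr_inject) auto
      have "?K \<noteq> 0" "?K \<noteq> top"
        using Kf by (force simp: ennreal_prod_eq_top)+
      then have Q: "0 < ?Q" "?Q < top"
        unfolding QK by (simp_all add: zero_less_iff_neq_zero flip: less_top)
      obtain E where E: "\<forall>j\<in>J. E j \<in> sets (M j)"
        "AE x in PiM J M. (\<forall>i\<in>J. K i (restrict x (J - {i})) \<noteq> 0) \<longleftrightarrow> (\<forall>j\<in>J. x j \<in> E j)"
        using IH QK Kf by blast
      have "AE x in PiM J M. Q x / ?Q = H e x / ?He"
        using nn_integral_Holder_extra_eqD[of "{()}" "\<lambda>_. ?b" ?a "H e" "PiM J M" "\<lambda>_. Q"] ab eq2 He Q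
        by simp
      with E(2) have "AE x in PiM J M. H e x \<noteq> 0 \<longleftrightarrow> (\<forall>j\<in>J. x j \<in> E j)"
      proof eventually_elim
        case (elim x)
        have "H e x = 0 \<longleftrightarrow> Q x = 0"
          using elim(2) He Q by (metis ennreal_divide_eq_0_iff less_irrefl)
        then show ?case
          using elim(1) J by (simp add: Q_def)
      qed
      then show ?thesis using E(1) by blast
    qed
    then show ?thesis
      using order_trans[OF L1 order_trans[OF L2 L3]] unfolding R J_def[symmetric] by blast
  qed
  obtain e where "e \<in> I" using I by fastforce
  then have "?L \<le> ?R"
    using step by blast
  moreover have "\<exists>E. (\<forall>j\<in>I. E j \<in> sets (M j)) \<and>
      (AE x in PiM I M. (\<forall>i\<in>I. H i (restrict x (I - {i})) \<noteq> 0) \<longleftrightarrow> (\<forall>j\<in>I. x j \<in> E j))"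
    if "?L = ?R" "\<forall>i\<in>I. 0 < (\<integral>\<^sup>+y. H i y \<partial>PiM (I - {i}) M) \<and> (\<integral>\<^sup>+y. H i y \<partial>PiM (I - {i}) M) < top"
    using step that I by (intro AE_PiM_product_support) auto
  ultimately show ?case by blast
qed

section \<open>Slices of null sets and functions independent of each coordinate\<close>

lemma AE_PiM_update_both:
  assumes I: "finite I" "e \<in> I" and P: "AE x in PiM I M. P x"
  shows AE_PiM_update: "AE y in PiM (I - {e}) M. AE t in M e. P (y(e := t))"
    and AE_PiM_update_rev: "AE t in M e. AE y in PiM (I - {e}) M. P (y(e := t))"
proof -
  let ?J = "PiM (I - {e}) M"
  interpret J: sigma_finite_measure ?J
    using I by (intro sigma_finite) auto
  interpret pair_sigma_finite ?J "M e"
    by unfold_locales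
  from P obtain N where N: "{x \<in> space (PiM I M). \<not> P x} \<subseteq> N"
    "emeasure (PiM I M) N = 0" "N \<in> sets (PiM I M)"
    by (rule AE_E)
  note N(3)[measurable]
  have upd [measurable]: "(\<lambda>z. (fst z)(e := snd z)) \<in> ?J \<Otimes>\<^sub>M M e \<rightarrow>\<^sub>M PiM I M"
    using measurable_add_dim[of e "I - {e}" M] I by (simp add: insert_absorb case_prod_unfold)
  have "(\<integral>\<^sup>+z. indicator N ((fst z)(e := snd z)) \<partial>(?J \<Otimes>\<^sub>M M e))
      = (\<integral>\<^sup>+y. (\<integral>\<^sup>+t. indicator N (y(e := t)) \<partial>M e) \<partial>?J)"
    by (subst M.nn_integral_fst[symmetric]) auto
  also have "\<dots> = (\<integral>\<^sup>+x. indicator N x \<partial>PiM I M)"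
    using I by (intro nn_integral_PiM_remove[symmetric]) auto
  also have "\<dots> = 0"
    using N by simp
  finally have "AE z in ?J \<Otimes>\<^sub>M M e. indicator N ((fst z)(e := snd z)) = (0 :: ennreal)"
    by (subst (asm) nn_integral_0_iff_AE) auto
  with AE_space have *: "AE z in ?J \<Otimes>\<^sub>M M e. P ((fst z)(e := snd z))"
  proof eventually_elim
    case (elim z)
    with measurable_space[OF upd elim(1)] N(1) show ?case
      by (auto simp: indicator_eq_0_iff)
  qed
  from AE_pair[OF this] show "AE y in ?J. AE t in M e. P (y(e := t))"
    by simp
  \<comment> \<open>Swapping the factors gives the other order of iteration, the one that allows a
    single value of coordinate \<open>e\<close> to be fixed.\<close>
  have "AE z in distr (M e \<Otimes>\<^sub>M ?J) (?J \<Otimes>\<^sub>M M e) (\<lambda>(x, y). (y, x)). P ((fst z)(e := snd z))"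
    using * by (subst distr_pair_swap[symmetric])
  from AE_distrD[OF measurable_pair_swap' this]
  have "AE z in M e \<Otimes>\<^sub>M ?J. P ((snd z)(e := fst z))"
    by (simp add: case_prod_unfold)
  interpret Q: pair_sigma_finite "M e" ?J
    by unfold_locales
  from Q.AE_pair[OF \<open>AE z in M e \<Otimes>\<^sub>M ?J. P ((snd z)(e := fst z))\<close>] show "AE t in M e. AE y in ?J. P (y(e := t))"
    by simp
qed

text \<open>Since \<open>E e\<close> has positive measure, it contains a value \<open>s\<close>
  whose slice satisfies all the hypotheses almost everywhere. The induction hypothesis makes
  \<open>g\<close> constant on that slice, and the representation of \<open>g\<close> by
  \<open>w e\<close> then spreads the constant in direction \<open>e\<close>.\<close>

lemma AE_PiM_const:
  assumes "finite I"
    and "\<And>j. j \<in> I \<Longrightarrow> E j \<in> sets (M j)" "\<And>j. j \<in> I \<Longrightarrow> 0 < emeasure (M j) (E j)"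
    and "\<And>i. i \<in> I \<Longrightarrow> AE x in PiM I M. (\<forall>j\<in>I. x j \<in> E j) \<longrightarrow> g x = w i (restrict x (I - {i}))"
  shows "\<exists>c. AE x in PiM I M. (\<forall>j\<in>I. x j \<in> E j) \<longrightarrow> g x = c"
  using assms
proof (induction I arbitrary: g w rule: finite_induct)
  case empty
  show ?case
    by (intro exI[of _ "g (\<lambda>_. undefined)"] AE_I2) (simp add: space_PiM)
next
  case (insert e J)
  let ?I = "insert e J"
  have J: "?I - {e} = J"
    using insert by auto
  have I: "finite ?I" "e \<in> ?I" using insert by auto
  let ?P = "\<lambda>s. \<forall>i\<in>?I. AE y in PiM J M. (\<forall>j\<in>?I. (y(e := s)) j \<in> E j) \<longrightarrow>
      g (y(e := s)) = w i (restrict (y(e := s)) (?I - {i}))"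
  have AE_P: "AE s in M e. ?P s"
    using AE_PiM_update_rev[OF I insert.prems(3)] insert.hyps(1)
    by (subst AE_ball_countable) (auto simp only: J finite_insert intro: countable_finite)
  obtain s where s: "s \<in> E e" "?P s"
  proof (rule ccontr)
    assume "\<not> thesis"
    then have no: "\<not> ?P s" if "s \<in> E e" for s
      using that \<open>\<And>s. s \<in> E e \<Longrightarrow> ?P s \<Longrightarrow> thesis\<close> by blast
    from AE_P have "AE s in M e. s \<notin> E e"
      by (rule eventually_mono) (use no in blast)
    then have "E e \<in> null_sets (M e)"
      using insert.prems(1)[of e] by (subst AE_iff_null_sets) auto
    then show False
      using insert.prems(2)[of e] by auto
  qed
  have "\<exists>c. AE y in PiM J M. (\<forall>j\<in>J. y j \<in> E j) \<longrightarrow> g (y(e := s)) = c"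
  proof (rule insert.IH[where w = "\<lambda>i z. w i (z(e := s))"])
    fix i assume i: "i \<in> J"
    have restr: "restrict (y(e := s)) (?I - {i}) = (restrict y (J - {i}))(e := s)" for y
      using i insert.hyps by (auto simp: fun_eq_iff)
    from s(2) i have "AE y in PiM J M. (\<forall>j\<in>?I. (y(e := s)) j \<in> E j) \<longrightarrow>
        g (y(e := s)) = w i (restrict (y(e := s)) (?I - {i}))"
      by blast
    then have "AE y in PiM J M. (\<forall>j\<in>?I. (y(e := s)) j \<in> E j) \<longrightarrow> g (y(e := s)) = w i ((restrict y (J - {i}))(e := s))"
      unfolding restr .
    then show "AE y in PiM J M. (\<forall>j\<in>J. y j \<in> E j) \<longrightarrow> g (y(e := s)) = w i ((restrict y (J - {i}))(e := s))"
      by eventually_elim (use s(1) in auto)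
  qed (use insert.prems in auto)
  then obtain c where c: "AE y in PiM J M. (\<forall>j\<in>J. y j \<in> E j) \<longrightarrow> g (y(e := s)) = c" ..
  \<comment> \<open>On the slice \<open>g\<close> equals both \<open>c\<close> and
    \<open>w e y\<close>. This determines \<open>w e\<close> on the base of the box, and
    \<open>w e\<close> does not see coordinate \<open>e\<close>.\<close>
  have "AE y in PiM J M. (\<forall>j\<in>?I. (y(e := s)) j \<in> E j) \<longrightarrow> g (y(e := s)) = w e (restrict (y(e := s)) (?I - {e}))"
    using s(2) by blast
  with c AE_space have "AE y in PiM (?I - {e}) M. (\<forall>j\<in>J. y j \<in> E j) \<longrightarrow> w e y = c"
    unfolding J
  proof eventually_elim
    case (elim y)
    have "restrict (y(e := s)) J = y"
      using elim(2) insert.hyps by (auto simp: space_PiM PiE_iff extensional_def fun_eq_iff)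
    then show ?case
      using elim(1,3) s(1) by auto
  qed
  from AE_PiM_restrict[OF I this] insert.prems(3)[OF I(2)]
  have "AE x in PiM ?I M. (\<forall>j\<in>?I. x j \<in> E j) \<longrightarrow> g x = c"
    unfolding J
  proof eventually_elim
    case (elim x)
    show ?case
    proof
      assume x: "\<forall>j\<in>?I. x j \<in> E j"
      then have "\<forall>j\<in>J. restrict x J j \<in> E j" by simp
      with elim(1) have "w e (restrict x J) = c" by blast
      with elim(2) x show "g x = c" by (metis (no_types))
    qed
  qed
  then show ?case ..
qed

end

section \<open>Norms of a function and of its marginals\<close>

text \<open>At \<open>a = 0\<close> both sides vanish even for \<open>r < 1\<close>, because
  \<open>0 powr s = 0\<close> for every \<open>s\<close>.\<close>

lemma epowr_mult_ennreal_powr: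
  assumes "a < top"
  shows "a * ennreal (enn2real a powr (r - 1)) = epowr a r"
proof -
  obtain x where x: "a = ennreal x" "0 \<le> x"
    using assms by (cases a) auto
  have "x * x powr (r - 1) = x powr r"
    using x(2) by (cases "x = 0") (simp_all add: powr_mult_base)
  then show ?thesis
    using x by (simp add: epowr_ennreal flip: ennreal_mult)
qed

text \<open>With d = \<open>card I\<close>, \<open>Suc n\<close> is d-1 and \<open>q\<close> is the
  family of exponents p_i. The endpoint p = 1 is left out: there the weight 1-p of
  \<open>LW_prod\<close> in Hoelder's inequality would be 0.\<close>

locale Loomis_Whitney_marginals = product_sigma_finite M
  for M :: "'i \<Rightarrow> 'a measure" +
  fixes I :: "'i set" and n :: nat and F :: "('i \<Rightarrow> 'a) \<Rightarrow> ennreal"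
    and p :: real and \<theta> q :: "'i \<Rightarrow> real"
  assumes finI: "finite I" and cardI: "card I = Suc (Suc n)"
    and F_meas: "F \<in> borel_measurable (PiM I M)" and F_top: "F x < top"
    and p: "0 < p" "p < 1"
    and \<theta>_pos: "i \<in> I \<Longrightarrow> 0 < \<theta> i" and \<theta>_sum: "(\<Sum>i\<in>I. \<theta> i) = 1"
    and q_eq: "i \<in> I \<Longrightarrow> 1 / real (Suc n) * (1 - 1 / p) = \<theta> i * (1 - 1 / q i)"
begin

abbreviation hat :: "('i \<Rightarrow> 'a) \<Rightarrow> 'i \<Rightarrow> 'i \<Rightarrow> 'a" where
  "hat x i \<equiv> restrict x (I - {i})"

definition marg :: "'i \<Rightarrow> ('i \<Rightarrow> 'a) \<Rightarrow> ennreal" where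
  "marg i y = (\<integral>\<^sup>+t. F (y(i := t)) \<partial>M i)"

definition X :: "'i \<Rightarrow> ennreal" where
  "X i = (\<integral>\<^sup>+y. epowr (marg i y) (q i) \<partial>PiM (I - {i}) M)"

text \<open>The value is 0 where the marginal is 0 or infinite.\<close>
definition wt :: "'i \<Rightarrow> ('i \<Rightarrow> 'a) \<Rightarrow> ennreal" where
  "wt i y = ennreal (enn2real (marg i y) powr (q i - 1))"

text \<open>The nested powers keep the shape of \<open>Loomis_Whitney_with_equality\<close>, with
  the \<open>q i\<close>-th power of \<open>marg i\<close> as \<open>H i\<close>.\<close>

definition LW_prod :: "('i \<Rightarrow> 'a) \<Rightarrow> ennreal" where
  "LW_prod x = (\<Prod>i\<in>I. epowr (epowr (marg i (hat x i)) (q i)) (1 / real (Suc n)))"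

section \<open>Exponents, measurability and the factorization\<close>

lemma I_ne: "I \<noteq> {}"
  using cardI by auto

lemma q_bounds:
  assumes "i \<in> I"
  shows "0 < q i" "q i < 1"
proof -
  have "1 / real (Suc n) * (1 - 1 / p) < 0"
    using p by (intro mult_pos_neg) (auto simp: field_simps)
  then have "1 - 1 / q i < 0"
    using \<theta>_pos[OF assms] q_eq[OF assms] by (simp add: mult_less_0_iff)
  then have *: "1 < 1 / q i" by simp
  then have "0 < 1 / q i" by linarith
  then show "0 < q i" by simp
  then show "q i < 1" using * by (simp add: field_simps)
qed

text \<open>The defining relation multiplied by p. It balances the exponents of \<open>X i\<close>:
  p \<theta>_i comes from Hoelder's inequality and (1-p)/(d-1) from Loomis--Whitney, while the
  left-hand side is what the i-th factor of the claim carries after taking p-th powers.\<close>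

lemma exponent_eq:
  assumes "i \<in> I"
  shows "p * \<theta> i / q i = p * \<theta> i + (1 - p) / real (Suc n)"
proof -
  have "p * (1 / real (Suc n) * (1 - 1 / p)) = p * (\<theta> i * (1 - 1 / q i))"
    using q_eq[OF assms] by simp
  moreover have "p * (1 / real (Suc n) * (1 - 1 / p)) = - ((1 - p) / real (Suc n))"
  proof -
    have "p * (1 / real (Suc n) * (1 - 1 / p)) = p * (1 - 1 / p) / real (Suc n)"
      by simp
    also have "p * (1 - 1 / p) = - (1 - p)"
      using p by (simp add: right_diff_distrib)
    finally show ?thesis
      by (simp only: minus_divide_left)
  qed
  moreover have "p * (\<theta> i * (1 - 1 / q i)) = p * \<theta> i - p * \<theta> i / q i"
    by (simp add: algebra_simps)
  ultimately show ?thesis by linarith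
qed

lemma marg_meas: "i \<in> I \<Longrightarrow> marg i \<in> borel_measurable (PiM (I - {i}) M)"
  unfolding marg_def by (intro borel_measurable_nn_integral_update F_meas)

lemma wt_meas: "i \<in> I \<Longrightarrow> wt i \<in> borel_measurable (PiM (I - {i}) M)"
  using marg_meas unfolding wt_def by measurable

lemma hat_meas: "(\<lambda>x. hat x i) \<in> PiM I M \<rightarrow>\<^sub>M PiM (I - {i}) M"
  by (rule measurable_restrict_subset) auto

lemma marg_hat_meas: "i \<in> I \<Longrightarrow> (\<lambda>x. marg i (hat x i)) \<in> borel_measurable (PiM I M)"
  by (rule measurable_compose[OF hat_meas marg_meas])

lemma wt_hat_meas: "i \<in> I \<Longrightarrow> (\<lambda>x. wt i (hat x i)) \<in> borel_measurable (PiM I M)"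
  by (rule measurable_compose[OF hat_meas wt_meas])

lemma LW_prod_meas: "LW_prod \<in> borel_measurable (PiM I M)"
  using marg_hat_meas unfolding LW_prod_def by measurable

lemma nn_integral_F_weight:
  assumes i: "i \<in> I" and v: "v \<in> borel_measurable (PiM (I - {i}) M)"
  shows "(\<integral>\<^sup>+x. F x * v (hat x i) \<partial>PiM I M) = (\<integral>\<^sup>+y. marg i y * v y \<partial>PiM (I - {i}) M)"
proof -
  note [measurable] = F_meas measurable_compose[OF hat_meas v]
  have "(\<integral>\<^sup>+x. F x * v (hat x i) \<partial>PiM I M)
      = (\<integral>\<^sup>+y. (\<integral>\<^sup>+t. F (y(i := t)) * v (hat (y(i := t)) i) \<partial>M i) \<partial>PiM (I - {i}) M)"
    using i finI by (intro nn_integral_PiM_remove) auto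
  also have "\<dots> = (\<integral>\<^sup>+y. (\<integral>\<^sup>+t. F (y(i := t)) * v y \<partial>M i) \<partial>PiM (I - {i}) M)"
    by (intro nn_integral_cong) (auto simp: restrict_fun_upd_Diff space_PiM PiE_iff)
  also have "\<dots> = (\<integral>\<^sup>+y. marg i y * v y \<partial>PiM (I - {i}) M)"
  proof (rule nn_integral_cong)
    fix y assume "y \<in> space (PiM (I - {i}) M)"
    then have [measurable]: "(\<lambda>t. F (y(i := t))) \<in> borel_measurable (M i)"
      using i by (intro measurable_compose[OF measurable_update_PiM F_meas])
    show "(\<integral>\<^sup>+t. F (y(i := t)) * v y \<partial>M i) = marg i y * v y"
      unfolding marg_def by (rule nn_integral_multc) measurable
  qed
  finally show ?thesis .
qed

text \<open>Weighting \<open>F\<close> with the indicator of the zero set of \<open>marg i\<close>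
  gives integral 0. This disposes of the points where a marginal is 0 and its negative power has no
  meaning.\<close>

lemma AE_F_zero:
  assumes i: "i \<in> I"
  shows "AE x in PiM I M. marg i (hat x i) = 0 \<longrightarrow> F x = 0"
proof -
  note [measurable] = F_meas marg_meas[OF i] marg_hat_meas[OF i]
  let ?v = "\<lambda>y. indicator {y. marg i y = 0} y :: ennreal"
  have [measurable]: "?v \<in> borel_measurable (PiM (I - {i}) M)"
    by (simp add: indicator_def of_bool_def)
  have "(\<integral>\<^sup>+x. F x * ?v (hat x i) \<partial>PiM I M) = (\<integral>\<^sup>+y. marg i y * ?v y \<partial>PiM (I - {i}) M)"
    by (rule nn_integral_F_weight[OF i]) measurable
  also have "\<dots> = (\<integral>\<^sup>+y. 0 \<partial>PiM (I - {i}) M)"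
    by (intro nn_integral_cong) (simp split: split_indicator)
  also have "\<dots> = 0" by simp
  finally have "(\<integral>\<^sup>+x. F x * ?v (hat x i) \<partial>PiM I M) = 0" .
  then have "AE x in PiM I M. F x * ?v (hat x i) = 0"
    by (subst (asm) nn_integral_0_iff_AE) (auto intro!: borel_measurable_times_ennreal measurable_compose[OF hat_meas])
  then show ?thesis
    by eventually_elim (auto simp: indicator_def split: if_splits)
qed

lemma AE_F_zero_of_X_zero:
  assumes i: "i \<in> I" "X i = 0"
  shows "AE x in PiM I M. F x = 0"
proof -
  note [measurable] = marg_meas[OF i(1)]
  have "AE y in PiM (I - {i}) M. epowr (marg i y) (q i) = 0"
    using i(2) unfolding X_def by (subst (asm) nn_integral_0_iff_AE) auto
  then have "AE y in PiM (I - {i}) M. marg i y = 0" by simp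
  from AE_PiM_restrict[OF finI i(1) this] AE_F_zero[OF i(1)]
  show ?thesis by eventually_elim simp
qed

lemma LW_marg:
  shows LW_marg_le: "(\<integral>\<^sup>+x. LW_prod x \<partial>PiM I M) \<le> (\<Prod>i\<in>I. epowr (X i) (1 / real (Suc n)))"
    and LW_marg_eqD: "\<lbrakk>(\<integral>\<^sup>+x. LW_prod x \<partial>PiM I M) = (\<Prod>i\<in>I. epowr (X i) (1 / real (Suc n)));
      \<forall>i\<in>I. 0 < X i \<and> X i < top\<rbrakk> \<Longrightarrow> \<exists>E. (\<forall>j\<in>I. E j \<in> sets (M j)) \<and>
        (AE x in PiM I M. (\<forall>i\<in>I. marg i (hat x i) \<noteq> 0) \<longleftrightarrow> (\<forall>j\<in>I. x j \<in> E j))"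
proof -
  have "(\<lambda>y. epowr (marg i y) (q i)) \<in> borel_measurable (PiM (I - {i}) M)" if "i \<in> I" for i
    using marg_meas[OF that] by measurable
  note * = Loomis_Whitney_with_equality[OF finI cardI, of "\<lambda>i y. epowr (marg i y) (q i)", OF this,
      folded X_def LW_prod_def]
  show "(\<integral>\<^sup>+x. LW_prod x \<partial>PiM I M) \<le> (\<Prod>i\<in>I. epowr (X i) (1 / real (Suc n)))"
    using * by blast
  assume "(\<integral>\<^sup>+x. LW_prod x \<partial>PiM I M) = (\<Prod>i\<in>I. epowr (X i) (1 / real (Suc n)))"
      "\<forall>i\<in>I. 0 < X i \<and> X i < top"
  with * show "\<exists>E. (\<forall>j\<in>I. E j \<in> sets (M j)) \<and>
        (AE x in PiM I M. (\<forall>i\<in>I. marg i (hat x i) \<noteq> 0) \<longleftrightarrow> (\<forall>j\<in>I. x j \<in> E j))"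
    unfolding epowr_eq_0_iff by blast
qed

text \<open>Where \<open>F\<close> vanishes, so does the product over \<open>I\<close>, whatever the
  value of \<open>LW_prod\<close>. Elsewhere all marginals are positive reals: their powers cancel,
  and the powers of \<open>F\<close> add up to p.\<close>

lemma factorization:
  assumes good: "F x = 0 \<or> (\<forall>i\<in>I. 0 < marg i (hat x i) \<and> marg i (hat x i) < top)"
  shows "epowr (F x) p = epowr (LW_prod x) (1 - p) * (\<Prod>i\<in>I. epowr (F x * wt i (hat x i)) (p * \<theta> i))"
proof (cases "F x = 0")
  case True
  then have "(\<Prod>i\<in>I. epowr (F x * wt i (hat x i)) (p * \<theta> i)) = 0"
    unfolding ennreal_prod_eq_0 using I_ne finI by auto
  with True show ?thesis by simp
next
  case False
  define g where "g i = enn2real (marg i (hat x i))" for i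
  have g: "marg i (hat x i) = ennreal (g i)" "0 < g i" if "i \<in> I" for i
    using good False that by (auto simp: g_def enn2real_positive_iff)
  let ?e = "\<lambda>i. q i * (1 / real (Suc n)) * (1 - p)" and ?e' = "\<lambda>i. (q i - 1) * (p * \<theta> i)"
  \<comment> \<open>This is \<open>exponent_eq\<close> multiplied by \<open>q i\<close>.\<close>
  have e: "?e i + ?e' i = 0" if "i \<in> I" for i
  proof -
    have "p * \<theta> i = q i * (p * \<theta> i / q i)"
      using q_bounds[OF that] by simp
    also have "\<dots> = q i * (p * \<theta> i + (1 - p) / real (Suc n))"
      by (simp only: exponent_eq[OF that])
    also have "\<dots> = q i * (p * \<theta> i) + q i * ((1 - p) / real (Suc n))"
      by (rule distrib_left)
    finally have "p * \<theta> i = q i * (p * \<theta> i) + q i * ((1 - p) / real (Suc n))" .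
    moreover have "?e i = q i * ((1 - p) / real (Suc n))" by simp
    moreover have "?e' i = q i * (p * \<theta> i) - p * \<theta> i" by (simp only: left_diff_distrib mult_1)
    ultimately show ?thesis by linarith
  qed
  have 1: "epowr (LW_prod x) (1 - p) = (\<Prod>i\<in>I. ennreal (g i powr ?e i))"
    unfolding LW_prod_def epowr_prod
  proof (rule prod.cong[OF refl])
    fix i assume "i \<in> I"
    then show "epowr (epowr (epowr (marg i (hat x i)) (q i)) (1 / real (Suc n))) (1 - p)
        = ennreal (g i powr ?e i)"
      unfolding epowr_epowr using g[of i] by (simp add: epowr_ennreal mult.assoc)
  qed
  have 2: "(\<Prod>i\<in>I. epowr (F x * wt i (hat x i)) (p * \<theta> i))
      = (\<Prod>i\<in>I. epowr (F x) (p * \<theta> i)) * (\<Prod>i\<in>I. ennreal (g i powr ?e' i))"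
    unfolding prod.distrib[symmetric]
  proof (rule prod.cong[OF refl])
    fix i assume "i \<in> I"
    show "epowr (F x * wt i (hat x i)) (p * \<theta> i) = epowr (F x) (p * \<theta> i) * ennreal (g i powr ?e' i)"
      by (simp add: epowr_mult wt_def g_def[symmetric] epowr_ennreal powr_powr)
  qed
  have 3: "(\<Prod>i\<in>I. epowr (F x) (p * \<theta> i)) = epowr (F x) p"
    using epowr_sum[OF finI I_ne, of "F x" "\<lambda>i. p * \<theta> i"] \<theta>_sum by (simp flip: sum_distrib_left)
  have 4: "(\<Prod>i\<in>I. ennreal (g i powr ?e i)) * (\<Prod>i\<in>I. ennreal (g i powr ?e' i)) = 1"
    unfolding prod.distrib[symmetric]
  proof (rule prod.neutral, rule ballI)
    fix i assume i: "i \<in> I"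
    have "ennreal (g i powr ?e i) * ennreal (g i powr ?e' i) = ennreal (g i powr (?e i + ?e' i))"
      unfolding powr_add by (rule ennreal_mult[symmetric]) auto
    then show "ennreal (g i powr ?e i) * ennreal (g i powr ?e' i) = 1"
      unfolding e[OF i] using g(2)[OF i] by simp
  qed
  show ?thesis
    unfolding 1 2 3 mult.left_commute[of _ "epowr (F x) p"] 4 by simp
qed

lemma AE_marg_finite:
  assumes i: "i \<in> I" "X i < top"
  shows "AE y in PiM (I - {i}) M. marg i y < top"
proof -
  note [measurable] = marg_meas[OF i(1)]
  have "AE y in PiM (I - {i}) M. epowr (marg i y) (q i) \<noteq> \<infinity>"
    using i(2) unfolding X_def by (intro nn_integral_PInf_AE) auto
  then show ?thesis
    by eventually_elim (simp flip: less_top)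
qed

lemma AE_good:
  assumes "\<forall>i\<in>I. X i < top"
  shows "AE x in PiM I M. F x = 0 \<or> (\<forall>i\<in>I. 0 < marg i (hat x i) \<and> marg i (hat x i) < top)"
proof -
  have "AE x in PiM I M. marg i (hat x i) < top \<and> (marg i (hat x i) = 0 \<longrightarrow> F x = 0)" if "i \<in> I" for i
    using AE_PiM_restrict[OF finI that AE_marg_finite[OF that]] AE_F_zero[OF that] assms that by auto
  then have "AE x in PiM I M. \<forall>i\<in>I. marg i (hat x i) < top \<and> (marg i (hat x i) = 0 \<longrightarrow> F x = 0)"
    using finI by (subst AE_ball_countable) (auto simp: countable_finite)
  then show ?thesis
    by eventually_elim (metis not_gr_zero)
qed

lemma nn_integral_F_wt:
  assumes i: "i \<in> I" "X i < top"
  shows "(\<integral>\<^sup>+x. F x * wt i (hat x i) \<partial>PiM I M) = X i"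
  unfolding nn_integral_F_weight[OF i(1) wt_meas[OF i(1)]] X_def
  using AE_marg_finite[OF i]
  by (intro nn_integral_cong_AE, eventually_elim) (simp add: wt_def epowr_mult_ennreal_powr)

lemma weights: "1 - p + (\<Sum>i\<in>I. p * \<theta> i) = 1"
  using \<theta>_sum by (simp flip: sum_distrib_left)

text \<open>The three links are kept apart because the equality case needs to know which of them is
  strict: Hoelder's inequality stops before Loomis--Whitney is applied, and the exponents are
  collected afterwards.\<close>

lemma chain:
  assumes X: "\<forall>i\<in>I. X i < top"
  shows "(\<integral>\<^sup>+x. epowr (F x) p \<partial>PiM I M)
      = (\<integral>\<^sup>+x. epowr (LW_prod x) (1 - p) * (\<Prod>i\<in>I. epowr (F x * wt i (hat x i)) (p * \<theta> i)) \<partial>PiM I M)"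
    and "(\<integral>\<^sup>+x. epowr (F x) p \<partial>PiM I M)
      \<le> epowr (\<integral>\<^sup>+x. LW_prod x \<partial>PiM I M) (1 - p) * (\<Prod>i\<in>I. epowr (X i) (p * \<theta> i))"
    and "epowr (\<Prod>i\<in>I. epowr (X i) (1 / real (Suc n))) (1 - p) * (\<Prod>i\<in>I. epowr (X i) (p * \<theta> i))
      = (\<Prod>i\<in>I. epowr (X i) (p * \<theta> i / q i))"
proof -
  show *: "(\<integral>\<^sup>+x. epowr (F x) p \<partial>PiM I M)
      = (\<integral>\<^sup>+x. epowr (LW_prod x) (1 - p) * (\<Prod>i\<in>I. epowr (F x * wt i (hat x i)) (p * \<theta> i)) \<partial>PiM I M)"
    using AE_good[OF X] by (intro nn_integral_cong_AE, eventually_elim) (rule factorization)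
  have m: "\<forall>i\<in>I. (\<lambda>x. F x * wt i (hat x i)) \<in> borel_measurable (PiM I M)"
    using F_meas wt_hat_meas by auto
  have "(\<integral>\<^sup>+x. epowr (F x) p \<partial>PiM I M)
      \<le> epowr (\<integral>\<^sup>+x. LW_prod x \<partial>PiM I M) (1 - p) * (\<Prod>i\<in>I. epowr (\<integral>\<^sup>+x. F x * wt i (hat x i) \<partial>PiM I M) (p * \<theta> i))"
    unfolding * by (rule nn_integral_Holder_extra_le) (use finI p \<theta>_pos weights LW_prod_meas m in auto)
  also have "(\<Prod>i\<in>I. epowr (\<integral>\<^sup>+x. F x * wt i (hat x i) \<partial>PiM I M) (p * \<theta> i)) = (\<Prod>i\<in>I. epowr (X i) (p * \<theta> i))"
    using X by (intro prod.cong) (auto simp: nn_integral_F_wt)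
  finally show "(\<integral>\<^sup>+x. epowr (F x) p \<partial>PiM I M)
      \<le> epowr (\<integral>\<^sup>+x. LW_prod x \<partial>PiM I M) (1 - p) * (\<Prod>i\<in>I. epowr (X i) (p * \<theta> i))" .
  show "epowr (\<Prod>i\<in>I. epowr (X i) (1 / real (Suc n))) (1 - p) * (\<Prod>i\<in>I. epowr (X i) (p * \<theta> i))
      = (\<Prod>i\<in>I. epowr (X i) (p * \<theta> i / q i))"
    unfolding epowr_prod prod.distrib[symmetric]
  proof (rule prod.cong[OF refl])
    fix i assume "i \<in> I"
    then show "epowr (epowr (X i) (1 / real (Suc n))) (1 - p) * epowr (X i) (p * \<theta> i) = epowr (X i) (p * \<theta> i / q i)"
      unfolding exponent_eq[OF \<open>i \<in> I\<close>] by (simp add: add.commute flip: epowr_add)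
  qed
qed

section \<open>The integral form of the inequality and its equality case\<close>

lemma inequality: "(\<integral>\<^sup>+x. epowr (F x) p \<partial>PiM I M) \<le> (\<Prod>i\<in>I. epowr (X i) (p * \<theta> i / q i))"
proof (cases "\<exists>i\<in>I. X i = 0")
  \<comment> \<open>One vanishing \<open>X i\<close> makes the right-hand side 0 regardless of
    infinite factors, so the left-hand side has to vanish as well.\<close>
  case True
  then obtain i where "i \<in> I" "X i = 0" by blast
  from AE_F_zero_of_X_zero[OF this] have "(\<integral>\<^sup>+x. epowr (F x) p \<partial>PiM I M) = (\<integral>\<^sup>+x. 0 \<partial>PiM I M)"
    by (intro nn_integral_cong_AE, eventually_elim) simp
  then show ?thesis by simp
next
  case nz: False
  show ?thesis
  proof (cases "\<exists>i\<in>I. X i = top")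
    case True
    then have "(\<Prod>i\<in>I. epowr (X i) (p * \<theta> i / q i)) = top"
      using nz finI by (auto simp: ennreal_prod_eq_top)
    then show ?thesis by simp
  next
    case False
    then have X: "\<forall>i\<in>I. X i < top" by (simp flip: less_top)
    show ?thesis
      using order_trans[OF chain(2)[OF X] mult_right_mono[OF epowr_mono[OF LW_marg_le, of "1 - p"]]]
        p unfolding chain(3)[OF X] by simp
  qed
qed

text \<open>Equal ends of the chain squeeze Hoelder and Loomis--Whitney into equalities. The common
  factor \<open>?T\<close> cancels because all \<open>X i\<close> are positive and finite, and the
  power 1-p can be inverted because p < 1.\<close>

lemma LW_prod_integral_eq:
  assumes X: "\<forall>i\<in>I. 0 < X i \<and> X i < top"
    and eq: "(\<integral>\<^sup>+x. epowr (F x) p \<partial>PiM I M) = (\<Prod>i\<in>I. epowr (X i) (p * \<theta> i / q i))"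
  shows "(\<integral>\<^sup>+x. LW_prod x \<partial>PiM I M) = (\<Prod>i\<in>I. epowr (X i) (1 / real (Suc n)))"
    and "AE x in PiM I M. \<forall>i\<in>I. F x * wt i (hat x i) / X i = LW_prod x / (\<integral>\<^sup>+x. LW_prod x \<partial>PiM I M)"
proof -
  let ?L = "\<integral>\<^sup>+x. LW_prod x \<partial>PiM I M" and ?R = "\<Prod>i\<in>I. epowr (X i) (1 / real (Suc n))"
    and ?T = "\<Prod>i\<in>I. epowr (X i) (p * \<theta> i)"
  have Xt: "\<forall>i\<in>I. X i < top" using X by blast
  have T: "?T \<noteq> 0" "?T \<noteq> top"
    using X by (force simp: ennreal_prod_eq_top)+
  have R: "?R \<noteq> 0" "?R \<noteq> top"
    using X by (force simp: ennreal_prod_eq_top)+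
  have "epowr ?R (1 - p) * ?T \<le> epowr ?L (1 - p) * ?T"
    unfolding chain(3)[OF Xt] eq[symmetric] by (rule chain(2)[OF Xt])
  moreover have "epowr ?L (1 - p) * ?T \<le> epowr ?R (1 - p) * ?T"
    using p by (intro mult_right_mono epowr_mono LW_marg_le) auto
  ultimately have LR: "epowr ?L (1 - p) * ?T = epowr ?R (1 - p) * ?T"
    by (rule antisym[rotated])
  then have "?T * epowr ?L (1 - p) = ?T * epowr ?R (1 - p)"
    by (simp only: mult.commute)
  then have "epowr ?L (1 - p) = epowr ?R (1 - p)"
    using T by (subst (asm) ennreal_mult_cancel_left) blast
  then show L: "?L = ?R"
    using p by (subst (asm) epowr_inject) auto
  have Lpos: "0 < ?L" "?L < top"
    unfolding L using R by (simp_all add: zero_less_iff_neq_zero flip: less_top)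
  have m: "\<forall>i\<in>I. (\<lambda>x. F x * wt i (hat x i)) \<in> borel_measurable (PiM I M)"
    using F_meas wt_hat_meas by auto
  have int: "\<forall>i\<in>I. (\<integral>\<^sup>+x. F x * wt i (hat x i) \<partial>PiM I M) = X i"
    using Xt nn_integral_F_wt by blast
  have T': "(\<Prod>i\<in>I. epowr (\<integral>\<^sup>+x. F x * wt i (hat x i) \<partial>PiM I M) (p * \<theta> i)) = ?T"
    using int by (intro prod.cong) auto
  have "AE x in PiM I M. \<forall>i\<in>I. F x * wt i (hat x i) / (\<integral>\<^sup>+x. F x * wt i (hat x i) \<partial>PiM I M) = LW_prod x / ?L"
  proof (rule nn_integral_Holder_extra_eqD[where a = "\<lambda>i. p * \<theta> i" and b = "1 - p"])
    show "(\<integral>\<^sup>+x. epowr (LW_prod x) (1 - p) * (\<Prod>i\<in>I. epowr (F x * wt i (hat x i)) (p * \<theta> i)) \<partial>PiM I M)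
        = epowr ?L (1 - p) * (\<Prod>i\<in>I. epowr (\<integral>\<^sup>+x. F x * wt i (hat x i) \<partial>PiM I M) (p * \<theta> i))"
      unfolding T' chain(1)[OF Xt, symmetric] eq LR chain(3)[OF Xt] by (rule refl)
  qed (use finI p \<theta>_pos weights LW_prod_meas m int X Lpos in auto)
  then show "AE x in PiM I M. \<forall>i\<in>I. F x * wt i (hat x i) / X i = LW_prod x / ?L"
    by eventually_elim (use int in simp)
qed

lemma marg_of_wt:
  assumes "0 < marg i y" "marg i y < top" "q i \<noteq> 1"
  shows "0 < wt i y" "wt i y < top" "marg i y = epowr (wt i y) (1 / (q i - 1))"
proof -
  obtain a where a: "marg i y = ennreal a" "0 < a"
    using assms(1,2) by (cases "marg i y") auto
  then show "0 < wt i y" "wt i y < top" "marg i y = epowr (wt i y) (1 / (q i - 1))"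
    using assms(3) by (simp_all add: wt_def epowr_ennreal powr_powr)
qed

lemma equality_imp_box:
  assumes X: "\<forall>i\<in>I. 0 < X i \<and> X i < top"
    and eq: "(\<integral>\<^sup>+x. epowr (F x) p \<partial>PiM I M) = (\<Prod>i\<in>I. epowr (X i) (p * \<theta> i / q i))"
  shows "\<exists>E c. 0 < c \<and>
    (\<forall>j\<in>I. E j \<in> sets (M j) \<and> 0 < emeasure (M j) (E j) \<and> emeasure (M j) (E j) < top) \<and>
    (AE x in PiM I M. F x = (if \<forall>j\<in>I. x j \<in> E j then ennreal c else 0))"
proof -
  define L where "L = (\<integral>\<^sup>+x. LW_prod x \<partial>PiM I M)"
  have Xt: "\<forall>i\<in>I. X i < top" using X by blast
  note Leq = LW_prod_integral_eq[OF X eq]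
  have "L \<noteq> 0" "L \<noteq> top"
    unfolding L_def Leq(1) using X by (force simp: ennreal_prod_eq_top)+
  obtain i0 where i0: "i0 \<in> I" using I_ne by blast
  obtain E where E: "\<forall>j\<in>I. E j \<in> sets (M j)"
    "AE x in PiM I M. (\<forall>i\<in>I. marg i (hat x i) \<noteq> 0) \<longleftrightarrow> (\<forall>j\<in>I. x j \<in> E j)"
    using LW_marg_eqD[OF Leq(1) X] by blast
  define B where "B x \<longleftrightarrow> (\<forall>j\<in>I. x j \<in> E j)" for x
  have base: "AE x in PiM I M. (F x \<noteq> 0 \<longleftrightarrow> B x) \<and>
      (B x \<longrightarrow> (\<forall>i\<in>I. 0 < marg i (hat x i) \<and> marg i (hat x i) < top)) \<and>
      (\<forall>i\<in>I. F x * (wt i (hat x i) / X i) = LW_prod x / L)"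
    using AE_good[OF Xt] E(2) Leq(2)[folded L_def]
  proof eventually_elim
    case (elim x)
    have FB: "F x \<noteq> 0 \<longleftrightarrow> B x"
    proof
      assume "F x \<noteq> 0"
      then have "\<forall>i\<in>I. marg i (hat x i) \<noteq> 0" using elim(1) by (metis less_irrefl)
      then show "B x" using elim(2) unfolding B_def by blast
    next
      \<comment> \<open>On the box no marginal vanishes, so \<open>LW_prod\<close> is nonzero; as
        \<open>L\<close> is finite, proportionality transfers this to \<open>F\<close>.\<close>
      assume "B x"
      then have "LW_prod x \<noteq> 0"
        using elim(2) unfolding LW_prod_def B_def by simp
      then have "LW_prod x / L \<noteq> 0"
        using \<open>L \<noteq> top\<close> by (simp add: ennreal_divide_eq_0_iff)
      moreover have "F x * wt i0 (hat x i0) / X i0 = LW_prod x / L"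
        using elim(3) i0 by blast
      ultimately show "F x \<noteq> 0" by auto
    qed
    then show ?case
      unfolding ennreal_times_divide using elim(1,3) by blast
  qed
  have E_Pi: "Pi\<^sub>E I E \<in> sets (PiM I M)"
    using E(1) finI by (intro sets_PiM_I_finite) auto
  have em: "emeasure (PiM I M) (Pi\<^sub>E I E) = (\<Prod>j\<in>I. emeasure (M j) (E j))"
    using E(1) finI by (intro emeasure_PiM) auto
  have B_Pi: "B x \<longleftrightarrow> x \<in> Pi\<^sub>E I E" if "x \<in> space (PiM I M)" for x
    using that by (auto simp: B_def space_PiM PiE_iff)
  have int_nz: "(\<integral>\<^sup>+x. epowr (F x) p \<partial>PiM I M) \<noteq> 0" and int_fin: "(\<integral>\<^sup>+x. epowr (F x) p \<partial>PiM I M) \<noteq> top"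
    unfolding eq using X by (force simp: ennreal_prod_eq_top)+
  have not_null: "\<not> (AE x in PiM I M. \<not> B x)"
  proof
    assume "AE x in PiM I M. \<not> B x"
    with base have "AE x in PiM I M. epowr (F x) p = 0"
      by eventually_elim simp
    then have "(\<integral>\<^sup>+x. epowr (F x) p \<partial>PiM I M) = (\<integral>\<^sup>+x. 0 \<partial>PiM I M)"
      by (rule nn_integral_cong_AE)
    with int_nz show False by simp
  qed
  have E_pos: "0 < emeasure (M j) (E j)" if j: "j \<in> I" for j
  proof (rule ccontr)
    assume "\<not> 0 < emeasure (M j) (E j)"
    then have "emeasure (PiM I M) (Pi\<^sub>E I E) = 0"
      unfolding em using j finI by (auto simp: not_gr_zero)
    then have "Pi\<^sub>E I E \<in> null_sets (PiM I M)"
      using E_Pi by blast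
    then have "AE x in PiM I M. x \<notin> Pi\<^sub>E I E"
      by (rule AE_not_in)
    with AE_space have "AE x in PiM I M. \<not> B x"
      by eventually_elim (simp add: B_Pi)
    with not_null show False ..
  qed
  \<comment> \<open>On the box \<open>F\<close> can be cancelled, so the quotients
    \<open>wt i (hat x i) / X i\<close> agree for all i. The i-th one ignores coordinate i, as
    \<open>AE_PiM_const\<close> requires.\<close>
  have "\<exists>c. AE x in PiM I M. (\<forall>j\<in>I. x j \<in> E j) \<longrightarrow> wt i0 (hat x i0) / X i0 = c"
  proof (rule AE_PiM_const[OF finI _ _, where w = "\<lambda>i y. wt i y / X i"])
    fix i assume i: "i \<in> I"
    from base show "AE x in PiM I M. (\<forall>j\<in>I. x j \<in> E j) \<longrightarrow> wt i0 (hat x i0) / X i0 = wt i (hat x i) / X i"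
    proof eventually_elim
      case (elim x)
      then have "F x * (wt i0 (hat x i0) / X i0) = F x * (wt i (hat x i) / X i)"
        using i i0 by simp
      then show ?case
        using elim F_top[of x] unfolding B_def[symmetric] by (auto simp: ennreal_mult_cancel_left)
    qed
  qed (use E(1) E_pos in auto)
  then obtain c where c: "AE x in PiM I M. B x \<longrightarrow> wt i0 (hat x i0) / X i0 = c"
    unfolding B_def by blast
  \<comment> \<open>On the box \<open>wt i\<close> equals \<open>c * X i\<close>, and inverting the
    power \<open>q i - 1\<close> recovers each marginal; \<open>k\<close> is the resulting value of
    \<open>LW_prod\<close>. The constant \<open>C\<close> then solves
    \<open>F x * c = k / L\<close>.\<close>
  define k where "k = (\<Prod>i\<in>I. epowr (epowr (epowr (c * X i) (1 / (q i - 1))) (q i)) (1 / real (Suc n)))"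
  define C where "C = k / L / c"
  have F_const: "AE x in PiM I M. B x \<longrightarrow> F x = C"
    using base c
  proof eventually_elim
    case (elim x)
    show ?case
    proof
      assume B: "B x"
      have F: "F x \<noteq> 0" "F x \<noteq> top"
        using elim(1) B F_top[of x] by auto
      have m: "0 < marg i (hat x i)" "marg i (hat x i) < top" if "i \<in> I" for i
        using elim(1) B that by auto
      have wc: "wt i (hat x i) / X i = c" if i: "i \<in> I" for i
      proof -
        have "F x * (wt i (hat x i) / X i) = F x * (wt i0 (hat x i0) / X i0)"
          using elim(1) i i0 by simp
        then show ?thesis
          using F elim(2) B by (auto simp: ennreal_mult_cancel_left)
      qed
      have wX: "wt i (hat x i) = c * X i" if i: "i \<in> I" for i
      proof -
        have "X i \<noteq> 0" "X i \<noteq> top" using X i by auto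
        then show ?thesis
          unfolding wc[OF i, symmetric]
          by (simp add: ennreal_divide_times ennreal_divide_self flip: less_top)
      qed
      have "LW_prod x = k"
        unfolding LW_prod_def k_def
      proof (rule prod.cong[OF refl])
        fix i assume i: "i \<in> I"
        have "marg i (hat x i) = epowr (c * X i) (1 / (q i - 1))"
          using marg_of_wt(3)[of i "hat x i"] m[OF i] q_bounds[OF i] wX[OF i] by simp
        then show "epowr (epowr (marg i (hat x i)) (q i)) (1 / real (Suc n))
            = epowr (epowr (epowr (c * X i) (1 / (q i - 1))) (q i)) (1 / real (Suc n))"
          by (simp only:)
      qed
      then have Fc: "F x * c = k / L"
        using elim(1) i0 wc[OF i0] by metis
      have "0 < wt i0 (hat x i0)" "wt i0 (hat x i0) < top"
        using marg_of_wt[of i0 "hat x i0"] m[OF i0] q_bounds[OF i0] by auto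
      then have "c \<noteq> 0" "c \<noteq> top"
        unfolding wX[OF i0] using X i0 by (auto simp: ennreal_top_mult split: if_splits)
      then show "F x = C"
        unfolding C_def Fc[symmetric] by (simp add: mult_divide_eq_ennreal)
    qed
  qed
  \<comment> \<open>The box is not null, so it has a point outside all exceptional sets; there
    \<open>C\<close> inherits positivity and finiteness from \<open>F\<close>.\<close>
  have "\<exists>x. B x \<and> F x = C \<and> F x \<noteq> 0"
  proof (rule ccontr)
    assume no: "\<nexists>x. B x \<and> F x = C \<and> F x \<noteq> 0"
    from F_const base have "AE x in PiM I M. \<not> B x"
      by eventually_elim (use no in blast)
    with not_null show False ..
  qed
  then have C: "C \<noteq> 0" "C < top"
    using F_top by metis+
  obtain r where r: "C = ennreal r" "0 < r"
    using C by (cases C) (auto simp: less_le)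
  have F_box: "AE x in PiM I M. F x = (if B x then ennreal r else 0)"
    using F_const base by eventually_elim (use r in auto)
  \<comment> \<open>As all sides have positive measure, one infinite side would make the whole box,
    and with it the integral of F^p, infinite.\<close>
  have E_fin: "emeasure (M j) (E j) < top" if j: "j \<in> I" for j
  proof (rule ccontr)
    assume "\<not> emeasure (M j) (E j) < top"
    then have "emeasure (M j) (E j) = top" by (simp flip: less_top)
    moreover have "\<forall>i\<in>I. emeasure (M i) (E i) \<noteq> 0"
      using E_pos by (metis less_irrefl)
    ultimately have "emeasure (PiM I M) (Pi\<^sub>E I E) = top"
      unfolding em using j finI by (auto simp: ennreal_prod_eq_top)
    moreover have "(\<integral>\<^sup>+x. epowr (F x) p \<partial>PiM I M) = (\<integral>\<^sup>+x. epowr C p * indicator (Pi\<^sub>E I E) x \<partial>PiM I M)"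
      using F_box AE_space
      by (intro nn_integral_cong_AE, eventually_elim) (auto simp: r B_Pi)
    ultimately have "(\<integral>\<^sup>+x. epowr (F x) p \<partial>PiM I M) = top"
      using E_Pi C by (simp add: nn_integral_cmult_indicator ennreal_mult_top)
    with int_fin show False ..
  qed
  show ?thesis
    using r E(1) E_pos E_fin F_box unfolding B_def by blast
qed

section \<open>Boxes attain equality\<close>

lemma nn_integral_box:
  assumes J: "J \<subseteq> I" and E: "\<forall>j\<in>I. E j \<in> sets (M j)"
  shows "(\<integral>\<^sup>+y. epowr (if \<forall>j\<in>J. y j \<in> E j then a else 0) r \<partial>PiM J M) = epowr a r * (\<Prod>j\<in>J. emeasure (M j) (E j))"
proof -
  have fin: "finite J" using J finI by (rule finite_subset)
  have m: "Pi\<^sub>E J E \<in> sets (PiM J M)"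
    using E J fin by (intro sets_PiM_I_finite) auto
  have "(\<integral>\<^sup>+y. epowr (if \<forall>j\<in>J. y j \<in> E j then a else 0) r \<partial>PiM J M)
      = (\<integral>\<^sup>+y. epowr a r * indicator (Pi\<^sub>E J E) y \<partial>PiM J M)"
    by (intro nn_integral_cong) (auto simp: space_PiM PiE_iff split: split_indicator)
  also have "\<dots> = epowr a r * emeasure (PiM J M) (Pi\<^sub>E J E)"
    by (rule nn_integral_cmult_indicator[OF m])
  also have "emeasure (PiM J M) (Pi\<^sub>E J E) = (\<Prod>j\<in>J. emeasure (M j) (E j))"
    using E J fin by (intro emeasure_PiM) auto
  finally show ?thesis .
qed

lemma box_imp_equality:
  assumes E: "\<forall>j\<in>I. E j \<in> sets (M j)"
    and F: "AE x in PiM I M. F x = (if \<forall>j\<in>I. x j \<in> E j then c else 0)"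
  shows "(\<integral>\<^sup>+x. epowr (F x) p \<partial>PiM I M) = (\<Prod>i\<in>I. epowr (X i) (p * \<theta> i / q i))"
proof -
  define A where "A j = emeasure (M j) (E j)" for j
  have X: "X i = epowr (c * A i) (q i) * (\<Prod>j\<in>I - {i}. A j)" if i: "i \<in> I" for i
  proof -
    have "AE y in PiM (I - {i}) M. marg i y = (if \<forall>j\<in>I - {i}. y j \<in> E j then c * A i else 0)"
      using AE_PiM_update[OF finI i F]
    proof eventually_elim
      case (elim y)
      have "marg i y = (\<integral>\<^sup>+t. (if \<forall>j\<in>I - {i}. y j \<in> E j then c else 0) * indicator (E i) t \<partial>M i)"
        unfolding marg_def
      proof (rule nn_integral_cong_AE, use elim in eventually_elim)
        case (elim t)
        have "(\<forall>j\<in>I. (y(i := t)) j \<in> E j) \<longleftrightarrow> t \<in> E i \<and> (\<forall>j\<in>I - {i}. y j \<in> E j)"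
          using i by auto
        with elim show ?case
          by (simp split: split_indicator)
      qed
      also have "\<dots> = (if \<forall>j\<in>I - {i}. y j \<in> E j then c else 0) * A i"
        using E i unfolding A_def by (intro nn_integral_cmult_indicator) auto
      finally show ?case by simp
    qed
    then have "X i = (\<integral>\<^sup>+y. epowr (if \<forall>j\<in>I - {i}. y j \<in> E j then c * A i else 0) (q i) \<partial>PiM (I - {i}) M)"
      unfolding X_def by (intro nn_integral_cong_AE, eventually_elim) simp
    then show ?thesis
      using E by (simp add: nn_integral_box A_def)
  qed
  have "(\<Prod>i\<in>I. epowr (X i) (p * \<theta> i / q i))
      = (\<Prod>i\<in>I. epowr c (p * \<theta> i) * (epowr (A i) (p * \<theta> i) * (\<Prod>j\<in>I - {i}. epowr (A j) (p * \<theta> i / q i))))"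
  proof (rule prod.cong[OF refl])
    fix i assume i: "i \<in> I"
    then have "q i * (p * \<theta> i / q i) = p * \<theta> i"
      using q_bounds[OF i] by simp
    then show "epowr (X i) (p * \<theta> i / q i)
        = epowr c (p * \<theta> i) * (epowr (A i) (p * \<theta> i) * (\<Prod>j\<in>I - {i}. epowr (A j) (p * \<theta> i / q i)))"
      unfolding X[OF i] by (simp only: epowr_mult epowr_prod epowr_epowr mult.assoc)
  qed
  also have "\<dots> = (\<Prod>i\<in>I. epowr c (p * \<theta> i)) * ((\<Prod>i\<in>I. epowr (A i) (p * \<theta> i)) *
      (\<Prod>i\<in>I. \<Prod>j\<in>I - {i}. epowr (A j) (p * \<theta> i / q i)))"
    by (simp only: prod.distrib)
  \<comment> \<open>Exchanging the double product brings all powers of a single \<open>A j\<close>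
    together.\<close>
  also have "(\<Prod>i\<in>I. \<Prod>j\<in>I - {i}. epowr (A j) (p * \<theta> i / q i))
      = (\<Prod>j\<in>I. \<Prod>i\<in>I - {j}. epowr (A j) (p * \<theta> i / q i))"
  proof -
    have "I - {i} = {j. j \<in> I \<and> i \<noteq> j}" "I - {i} = {j. j \<in> I \<and> j \<noteq> i}" for i by auto
    then show ?thesis
      using prod.swap_restrict[OF finI finI, of "\<lambda>i j. epowr (A j) (p * \<theta> i / q i)" "\<lambda>i j. i \<noteq> j"]
      by (simp only:)
  qed
  also have "(\<Prod>i\<in>I. epowr (A i) (p * \<theta> i)) * (\<Prod>j\<in>I. \<Prod>i\<in>I - {j}. epowr (A j) (p * \<theta> i / q i)) = (\<Prod>j\<in>I. A j)"
    unfolding prod.distrib[symmetric]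
  proof (rule prod.cong[OF refl])
    fix j assume j: "j \<in> I"
    have card: "card (I - {j}) = Suc n"
      using cardI finI j by simp
    then have "I - {j} \<noteq> {}" by force
    then have "epowr (A j) (p * \<theta> j) * (\<Prod>i\<in>I - {j}. epowr (A j) (p * \<theta> i / q i))
        = epowr (A j) (p * \<theta> j + (\<Sum>i\<in>I - {j}. p * \<theta> i / q i))"
      using finI by (simp add: epowr_add epowr_sum)
    \<comment> \<open>Each of the d-1 indices i \<noteq> j contributes p \<theta>_i + (1-p)/(d-1),
      which adds up to p (1-\<theta>_j) + (1-p).\<close>
    also have "p * \<theta> j + (\<Sum>i\<in>I - {j}. p * \<theta> i / q i) = 1"
    proof -
      have "(\<Sum>i\<in>I - {j}. p * \<theta> i / q i) = (\<Sum>i\<in>I - {j}. p * \<theta> i + (1 - p) / real (Suc n))"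
        by (rule sum.cong[OF refl]) (simp only: exponent_eq Diff_iff)
      also have "\<dots> = p * (\<Sum>i\<in>I - {j}. \<theta> i) + (1 - p)"
        unfolding sum.distrib sum_constant card by (simp add: sum_distrib_left)
      also have "(\<Sum>i\<in>I - {j}. \<theta> i) = 1 - \<theta> j"
        using \<theta>_sum sum.remove[OF finI j, of \<theta>] by simp
      finally show ?thesis by (simp add: algebra_simps)
    qed
    finally show "epowr (A j) (p * \<theta> j) * (\<Prod>i\<in>I - {j}. epowr (A j) (p * \<theta> i / q i)) = A j"
      by simp
  qed
  also have "(\<Prod>i\<in>I. epowr c (p * \<theta> i)) = epowr c p"
    using epowr_sum[OF finI I_ne, of c "\<lambda>i. p * \<theta> i"] \<theta>_sum by (simp flip: sum_distrib_left)
  finally have "(\<Prod>i\<in>I. epowr (X i) (p * \<theta> i / q i)) = epowr c p * (\<Prod>j\<in>I. A j)" .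
  moreover have "(\<integral>\<^sup>+x. epowr (F x) p \<partial>PiM I M) = epowr c p * (\<Prod>j\<in>I. A j)"
  proof -
    have "(\<integral>\<^sup>+x. epowr (F x) p \<partial>PiM I M) = (\<integral>\<^sup>+x. epowr (if \<forall>j\<in>I. x j \<in> E j then c else 0) p \<partial>PiM I M)"
      using F by (intro nn_integral_cong_AE, eventually_elim) simp
    then show ?thesis
      unfolding A_def nn_integral_box[OF order_refl E] .
  qed
  ultimately show ?thesis by simp
qed

section \<open>From integrals to norms\<close>

lemma Lp_norm_F: "Lp_norm (PiM I M) p F = epowr (\<integral>\<^sup>+x. epowr (F x) p \<partial>PiM I M) (1 / p)"
  by (simp add: Lp_norm_def)

lemma prod_Lp_norm_marg:
  "(\<Prod>i\<in>I. epowr (Lp_norm (PiM (I - {i}) M) (q i) (marg i)) (\<theta> i))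
    = epowr (\<Prod>i\<in>I. epowr (X i) (p * \<theta> i / q i)) (1 / p)"
  unfolding epowr_prod
  by (rule prod.cong[OF refl]) (use p in \<open>simp add: Lp_norm_def X_def\<close>)

lemma Lp_norm_le: "Lp_norm (PiM I M) p F \<le> (\<Prod>i\<in>I. epowr (Lp_norm (PiM (I - {i}) M) (q i) (marg i)) (\<theta> i))"
  unfolding Lp_norm_F prod_Lp_norm_marg using p by (intro epowr_mono inequality) auto

lemma Lp_norm_eq_iff:
  assumes "0 < (\<Prod>i\<in>I. epowr (Lp_norm (PiM (I - {i}) M) (q i) (marg i)) (\<theta> i))"
    and "(\<Prod>i\<in>I. epowr (Lp_norm (PiM (I - {i}) M) (q i) (marg i)) (\<theta> i)) < top"
  shows "Lp_norm (PiM I M) p F = (\<Prod>i\<in>I. epowr (Lp_norm (PiM (I - {i}) M) (q i) (marg i)) (\<theta> i)) \<longleftrightarrow>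
    (\<exists>E c. (\<forall>j\<in>I. E j \<in> sets (M j) \<and> 0 < emeasure (M j) (E j) \<and> emeasure (M j) (E j) < top) \<and> 0 < c \<and>
      (AE x in PiM I M. F x = (if \<forall>j\<in>I. x j \<in> E j then ennreal c else 0)))"
    (is "?eq \<longleftrightarrow> ?box")
proof -
  have "(\<Prod>i\<in>I. epowr (X i) (p * \<theta> i / q i)) \<noteq> 0" "(\<Prod>i\<in>I. epowr (X i) (p * \<theta> i / q i)) \<noteq> top"
    using assms unfolding prod_Lp_norm_marg
    by (metis epowr_0 less_irrefl, metis epowr_less_top_iff less_irrefl)
  \<comment> \<open>A finite product without zero factors has no infinite factor.\<close>
  then have X: "\<forall>i\<in>I. 0 < X i \<and> X i < top"
    unfolding ennreal_prod_eq_0 ennreal_prod_eq_top epowr_eq_0_iff epowr_eq_top_iff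
    using finI by (metis less_top not_gr_zero)
  have iff: "?eq \<longleftrightarrow> (\<integral>\<^sup>+x. epowr (F x) p \<partial>PiM I M) = (\<Prod>i\<in>I. epowr (X i) (p * \<theta> i / q i))"
    unfolding Lp_norm_F prod_Lp_norm_marg using p by (intro epowr_inject) auto
  show ?thesis
    unfolding iff using equality_imp_box[OF X] box_imp_equality by blast
qed

end

section \<open>Real-valued functions and the index set \<open>{1..d}\<close>\<close>

lemma prod_indicator_eq_if:
  assumes "finite I"
  shows "(\<Prod>j\<in>I. indicator (E j) (x j)) = (if \<forall>j\<in>I. x j \<in> E j then 1 else 0 :: real)"
  using assms by (induction I rule: finite_induct) (auto split: split_indicator)

theorem (in product_sigma_finite) Loomis_Whitney:
  fixes g :: "'i \<Rightarrow> ('i \<Rightarrow> 'a) \<Rightarrow> real"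
  assumes I: "finite I" "card I = Suc (Suc n)"
    and g: "\<And>i. i \<in> I \<Longrightarrow> g i \<in> borel_measurable (PiM (I - {i}) M)"
      "\<And>i y. i \<in> I \<Longrightarrow> y \<in> space (PiM (I - {i}) M) \<Longrightarrow> 0 \<le> g i y"
  shows "(\<integral>\<^sup>+x. ennreal (\<Prod>i\<in>I. g i (restrict x (I - {i}))) \<partial>PiM I M)
    \<le> (\<Prod>i\<in>I. Lp_norm (PiM (I - {i}) M) (real (Suc n)) (\<lambda>y. ennreal (g i y)))"
proof -
  have m: "(\<lambda>y. epowr (ennreal (g i y)) (real (Suc n))) \<in> borel_measurable (PiM (I - {i}) M)" if "i \<in> I" for i
    using g(1)[OF that] by measurable
  have restr: "(\<lambda>x. restrict x (I - {i})) \<in> PiM I M \<rightarrow>\<^sub>M PiM (I - {i}) M" for i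
    by (rule measurable_restrict_subset) auto
  have "(\<integral>\<^sup>+x. ennreal (\<Prod>i\<in>I. g i (restrict x (I - {i}))) \<partial>PiM I M) =
      (\<integral>\<^sup>+x. (\<Prod>i\<in>I. epowr (epowr (ennreal (g i (restrict x (I - {i})))) (real (Suc n))) (1 / real (Suc n))) \<partial>PiM I M)"
  proof (rule nn_integral_cong)
    fix x assume "x \<in> space (PiM I M)"
    then have "0 \<le> g i (restrict x (I - {i}))" if "i \<in> I" for i
      using g(2)[OF that] measurable_space[OF restr] by blast
    then have "ennreal (\<Prod>i\<in>I. g i (restrict x (I - {i}))) = (\<Prod>i\<in>I. ennreal (g i (restrict x (I - {i}))))"
      by (simp add: prod_ennreal)
    then show "ennreal (\<Prod>i\<in>I. g i (restrict x (I - {i})))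
        = (\<Prod>i\<in>I. epowr (epowr (ennreal (g i (restrict x (I - {i})))) (real (Suc n))) (1 / real (Suc n)))"
      by (simp del: of_nat_Suc)
  qed
  also have "\<dots> \<le> (\<Prod>i\<in>I. Lp_norm (PiM (I - {i}) M) (real (Suc n)) (\<lambda>y. ennreal (g i y)))"
    unfolding Lp_norm_def
    using Loomis_Whitney_with_equality[OF I, of "\<lambda>i y. epowr (ennreal (g i y)) (real (Suc n))", OF m] by blast
  finally show ?thesis .
qed

theorem theorem2p1:
  fixes M :: "nat \<Rightarrow> 'a measure" and d :: nat
  assumes d2: "d \<ge> 2"
    and sf: "\<forall>i\<in>{1..d}. sigma_finite_measure (M i)"
  shows
  \<comment> \<open>(i) Loomis--Whitney\<close>
  "(\<forall>g :: nat \<Rightarrow> (nat \<Rightarrow> 'a) \<Rightarrow> real.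
      (\<forall>i\<in>{1..d}. g i \<in> borel_measurable (Pi\<^sub>M ({1..d} - {i}) M)
         \<and> (\<forall>y\<in>space (Pi\<^sub>M ({1..d} - {i}) M). g i y \<ge> 0)) \<longrightarrow>
      (\<integral>\<^sup>+ x. ennreal (\<Prod>i\<in>{1..d}. g i (restrict x ({1..d} - {i}))) \<partial>(Pi\<^sub>M {1..d} M))
        \<le> (\<Prod>i\<in>{1..d}. Lp_norm (Pi\<^sub>M ({1..d} - {i}) M) (real d - 1) (\<lambda>y. ennreal (g i y))))
   \<and>
  \<comment> \<open>(ii) general form\<close>
   (\<forall>(f :: (nat \<Rightarrow> 'a) \<Rightarrow> real) p (\<theta> :: nat \<Rightarrow> real) (q :: nat \<Rightarrow> real).
      f \<in> borel_measurable (Pi\<^sub>M {1..d} M) \<and> (\<forall>x\<in>space (Pi\<^sub>M {1..d} M). f x \<ge> 0)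
      \<and> 0 < p \<and> p \<le> 1 \<and> (\<forall>i\<in>{1..d}. \<theta> i > 0) \<and> (\<Sum>i\<in>{1..d}. \<theta> i) = 1
      \<and> (\<forall>i\<in>{1..d}. 1 / (real d - 1) * (1 - 1 / p) = \<theta> i * (1 - 1 / q i)) \<longrightarrow>
      Lp_norm (Pi\<^sub>M {1..d} M) p (\<lambda>x. ennreal (f x))
        \<le> (\<Prod>i\<in>{1..d}. epowr (Lp_norm (Pi\<^sub>M ({1..d} - {i}) M) (q i) (marginal M i f)) (\<theta> i)))
   \<and>
  \<comment> \<open>(ii) special case \<open>\<theta>_i = 1/d\<close>\<close>
   (\<forall>(f :: (nat \<Rightarrow> 'a) \<Rightarrow> real) p.
      f \<in> borel_measurable (Pi\<^sub>M {1..d} M) \<and> (\<forall>x\<in>space (Pi\<^sub>M {1..d} M). f x \<ge> 0)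
      \<and> 0 < p \<and> p \<le> 1 \<longrightarrow>
      Lp_norm (Pi\<^sub>M {1..d} M) p (\<lambda>x. ennreal (f x))
        \<le> (\<Prod>i\<in>{1..d}. epowr (Lp_norm (Pi\<^sub>M ({1..d} - {i}) M)
                 (p * (real d - 1) / (real d - p)) (marginal M i f)) (1 / real d)))
   \<and>
  \<comment> \<open>(iii) characterisation of equality for \<open>p < 1\<close>\<close>
   (\<forall>(f :: (nat \<Rightarrow> 'a) \<Rightarrow> real) p (\<theta> :: nat \<Rightarrow> real) (q :: nat \<Rightarrow> real).
      f \<in> borel_measurable (Pi\<^sub>M {1..d} M) \<and> (\<forall>x\<in>space (Pi\<^sub>M {1..d} M). f x \<ge> 0)
      \<and> 0 < p \<and> p < 1 \<and> (\<forall>i\<in>{1..d}. \<theta> i > 0) \<and> (\<Sum>i\<in>{1..d}. \<theta> i) = 1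
      \<and> (\<forall>i\<in>{1..d}. 1 / (real d - 1) * (1 - 1 / p) = \<theta> i * (1 - 1 / q i))
      \<and> 0 < Lp_norm (Pi\<^sub>M {1..d} M) p (\<lambda>x. ennreal (f x))
      \<and> Lp_norm (Pi\<^sub>M {1..d} M) p (\<lambda>x. ennreal (f x)) < \<infinity>
      \<and> 0 < (\<Prod>i\<in>{1..d}. epowr (Lp_norm (Pi\<^sub>M ({1..d} - {i}) M) (q i) (marginal M i f)) (\<theta> i))
      \<and> (\<Prod>i\<in>{1..d}. epowr (Lp_norm (Pi\<^sub>M ({1..d} - {i}) M) (q i) (marginal M i f)) (\<theta> i)) < \<infinity>
      \<longrightarrow>
      (Lp_norm (Pi\<^sub>M {1..d} M) p (\<lambda>x. ennreal (f x))
         = (\<Prod>i\<in>{1..d}. epowr (Lp_norm (Pi\<^sub>M ({1..d} - {i}) M) (q i) (marginal M i f)) (\<theta> i))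
       \<longleftrightarrow>
       (\<exists>(E :: nat \<Rightarrow> 'a set) (c :: real).
          (\<forall>j\<in>{1..d}. E j \<in> sets (M j) \<and> 0 < emeasure (M j) (E j) \<and> emeasure (M j) (E j) < \<infinity>)
          \<and> c > 0
          \<and> (AE x in Pi\<^sub>M {1..d} M. f x = c * (\<Prod>j\<in>{1..d}. indicator (E j) (x j))))))"
proof -
  \<comment> \<open>The locale \<open>product_sigma_finite\<close> asks for sigma-finiteness at
    every natural number, while it is given on \<open>{1..d}\<close> only. Outside that range an
    empty measure space is substituted, which leaves all the products in question unchanged.\<close>
  define N where "N i = (if i \<in> {1..d} then M i else count_space {})" for i
  interpret N: product_sigma_finite N
  proof (rule product_sigma_finite.intro)
    fix i show "sigma_finite_measure (N i)"
      using sf by (auto simp: N_def intro!: sigma_finite_measure_count_space_finite)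
  qed
  obtain n where n: "d = Suc (Suc n)"
    using d2 by (metis add_2_eq_Suc le_Suc_ex)
  have card: "card {1..d} = Suc (Suc n)" and d1: "real d - 1 = real (Suc n)"
    using n by simp_all
  have PiM_N: "PiM {1..d} M = PiM {1..d} N"
    by (rule PiM_cong) (simp_all add: N_def)
  have PiM_N': "PiM ({1..d} - {i}) M = PiM ({1..d} - {i}) N" for i
    by (rule PiM_cong) (simp_all add: N_def)
  have marg: "marginal M i f = (\<lambda>y. \<integral>\<^sup>+t. ennreal (f (y(i := t))) \<partial>N i)" if "i \<in> {1..d}" for i f
    using that by (simp add: marginal_def fun_eq_iff N_def)
  have rhs: "(\<Prod>i\<in>{1..d}. epowr (Lp_norm (PiM ({1..d} - {i}) M) (q i) (marginal M i f)) (\<theta> i))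
      = (\<Prod>i\<in>{1..d}. epowr (Lp_norm (PiM ({1..d} - {i}) N) (q i) (\<lambda>y. \<integral>\<^sup>+t. ennreal (f (y(i := t))) \<partial>N i)) (\<theta> i))"
    for f :: "(nat \<Rightarrow> 'a) \<Rightarrow> real" and q \<theta> :: "nat \<Rightarrow> real"
    by (rule prod.cong[OF refl]) (simp only: marg PiM_N')
  have locale_N: "Loomis_Whitney_marginals N {1..d} n (\<lambda>x. ennreal (f x)) p \<theta> q"
    if "f \<in> borel_measurable (PiM {1..d} M)" "0 < p" "p < 1"
      "\<forall>i\<in>{1..d}. \<theta> i > 0" "(\<Sum>i\<in>{1..d}. \<theta> i) = 1"
      "\<forall>i\<in>{1..d}. 1 / (real d - 1) * (1 - 1 / p) = \<theta> i * (1 - 1 / q i)"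
    for f :: "(nat \<Rightarrow> 'a) \<Rightarrow> real" and p and q \<theta> :: "nat \<Rightarrow> real"
  proof
    show "(\<lambda>x. ennreal (f x)) \<in> borel_measurable (PiM {1..d} N)"
      using that(1) unfolding PiM_N by measurable
    show "1 / real (Suc n) * (1 - 1 / p) = \<theta> i * (1 - 1 / q i)" if "i \<in> {1..d}" for i
      using \<open>\<forall>i\<in>{1..d}. 1 / (real d - 1) * (1 - 1 / p) = \<theta> i * (1 - 1 / q i)\<close> that
      unfolding d1 by blast
  qed (use that card in auto)
  have general: "Lp_norm (PiM {1..d} M) p (\<lambda>x. ennreal (f x))
        \<le> (\<Prod>i\<in>{1..d}. epowr (Lp_norm (PiM ({1..d} - {i}) M) (q i) (marginal M i f)) (\<theta> i))"
    if f: "f \<in> borel_measurable (PiM {1..d} M)" and p: "0 < p" "p \<le> 1"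
      and \<theta>: "\<forall>i\<in>{1..d}. \<theta> i > 0" "(\<Sum>i\<in>{1..d}. \<theta> i) = 1"
      and q: "\<forall>i\<in>{1..d}. 1 / (real d - 1) * (1 - 1 / p) = \<theta> i * (1 - 1 / q i)"
    for f :: "(nat \<Rightarrow> 'a) \<Rightarrow> real" and p and q \<theta> :: "nat \<Rightarrow> real"
  proof (cases "p = 1")
    case False
    then interpret Loomis_Whitney_marginals N "{1..d}" n "\<lambda>x. ennreal (f x)" p \<theta> q
      using locale_N[OF f _ _ \<theta> q] p by simp
    show ?thesis
      using Lp_norm_le unfolding rhs PiM_N marg_def .
  next
    \<comment> \<open>For p = 1 all exponents \<open>q i\<close> are 1, so by Tonelli every norm on
      the right is the integral of f, and the weights \<theta>_i add up to 1.\<close>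
    case True
    have q1: "q i = 1" if "i \<in> {1..d}" for i
    proof -
      have "\<theta> i * (1 - 1 / q i) = 0"
        using q that True by simp
      then have "1 / q i = 1"
        using \<theta>(1) that by force
      then show ?thesis
        by (metis div_by_0 divide_eq_1_iff zero_neq_one)
    qed
    let ?S = "\<integral>\<^sup>+x. ennreal (f x) \<partial>PiM {1..d} N"
    have fm: "(\<lambda>x. ennreal (f x)) \<in> borel_measurable (PiM {1..d} N)"
      using f unfolding PiM_N by measurable
    have "(\<Prod>i\<in>{1..d}. epowr (Lp_norm (PiM ({1..d} - {i}) N) (q i) (\<lambda>y. \<integral>\<^sup>+t. ennreal (f (y(i := t))) \<partial>N i)) (\<theta> i))
        = (\<Prod>i\<in>{1..d}. epowr ?S (\<theta> i))"
      by (rule prod.cong[OF refl])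
        (simp only: q1 Lp_norm_def epowr_exp_1 div_by_1 N.nn_integral_PiM_remove[OF finite_atLeastAtMost _ fm])
    also have "\<dots> = epowr ?S (\<Sum>i\<in>{1..d}. \<theta> i)"
      using n by (intro epowr_sum[symmetric]) auto
    also have "\<dots> = ?S"
      unfolding \<theta>(2) by (rule epowr_exp_1)
    finally show ?thesis
      unfolding rhs PiM_N True by (simp add: Lp_norm_def)
  qed
  have special: "Lp_norm (PiM {1..d} M) p (\<lambda>x. ennreal (f x))
        \<le> (\<Prod>i\<in>{1..d}. epowr (Lp_norm (PiM ({1..d} - {i}) M)
                 (p * (real d - 1) / (real d - p)) (marginal M i f)) (1 / real d))"
    if f: "f \<in> borel_measurable (PiM {1..d} M)" and p: "0 < p" "p \<le> 1"
    for f :: "(nat \<Rightarrow> 'a) \<Rightarrow> real" and p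
  proof (rule general[OF f p])
    \<comment> \<open>With \<theta>_i = 1/d the relation for q_i reads 1 - 1/q_i = d (p-1) / (p
      (d-1)), and p (d-1)/(d-p) is its solution.\<close>
    have "1 - 1 / (p * (real d - 1) / (real d - p)) = (real d * (p - 1)) / (p * (real d - 1))"
      using p d2 by (simp add: field_simps)
    then show "\<forall>i\<in>{1..d}. 1 / (real d - 1) * (1 - 1 / p) = 1 / real d * (1 - 1 / (p * (real d - 1) / (real d - p)))"
      using p d2 by (simp add: field_simps)
  qed (use d2 in auto)
  have equality: "(Lp_norm (PiM {1..d} M) p (\<lambda>x. ennreal (f x))
         = (\<Prod>i\<in>{1..d}. epowr (Lp_norm (PiM ({1..d} - {i}) M) (q i) (marginal M i f)) (\<theta> i))) \<longleftrightarrow>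
       (\<exists>(E :: nat \<Rightarrow> 'a set) (c :: real).
          (\<forall>j\<in>{1..d}. E j \<in> sets (M j) \<and> 0 < emeasure (M j) (E j) \<and> emeasure (M j) (E j) < \<infinity>)
          \<and> c > 0
          \<and> (AE x in PiM {1..d} M. f x = c * (\<Prod>j\<in>{1..d}. indicator (E j) (x j))))"
    if f: "f \<in> borel_measurable (PiM {1..d} M)" "\<forall>x\<in>space (PiM {1..d} M). f x \<ge> 0" and p: "0 < p" "p < 1"
      and \<theta>: "\<forall>i\<in>{1..d}. \<theta> i > 0" "(\<Sum>i\<in>{1..d}. \<theta> i) = 1"
      and q: "\<forall>i\<in>{1..d}. 1 / (real d - 1) * (1 - 1 / p) = \<theta> i * (1 - 1 / q i)"
      and pos: "0 < (\<Prod>i\<in>{1..d}. epowr (Lp_norm (PiM ({1..d} - {i}) M) (q i) (marginal M i f)) (\<theta> i))"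
      and fin: "(\<Prod>i\<in>{1..d}. epowr (Lp_norm (PiM ({1..d} - {i}) M) (q i) (marginal M i f)) (\<theta> i)) < \<infinity>"
    for f :: "(nat \<Rightarrow> 'a) \<Rightarrow> real" and p and q \<theta> :: "nat \<Rightarrow> real"
  proof -
    interpret Loomis_Whitney_marginals N "{1..d}" n "\<lambda>x. ennreal (f x)" p \<theta> q
      by (rule locale_N[OF f(1) p \<theta> q])
    \<comment> \<open>Since \<open>ennreal\<close> sends negative numbers to 0, the return to real
      values needs f \<ge> 0, which is available on the space of the product.\<close>
    have AE_iff: "(AE x in PiM {1..d} N. ennreal (f x) = (if \<forall>j\<in>{1..d}. x j \<in> E j then ennreal c else 0)) \<longleftrightarrow>
        (AE x in PiM {1..d} N. f x = c * (\<Prod>j\<in>{1..d}. indicator (E j) (x j)))" if "0 < c" for E c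
    proof (rule AE_cong)
      fix x assume "x \<in> space (PiM {1..d} N)"
      then have "0 \<le> f x" using f(2) unfolding PiM_N by blast
      then show "(ennreal (f x) = (if \<forall>j\<in>{1..d}. x j \<in> E j then ennreal c else 0)) \<longleftrightarrow>
          f x = c * (\<Prod>j\<in>{1..d}. indicator (E j) (x j))"
        using that by (simp only: prod_indicator_eq_if[OF finite_atLeastAtMost]) (simp add: ennreal_eq_0_iff)
    qed
    have sets_N: "(\<forall>j\<in>{1..d}. E j \<in> sets (M j) \<and> 0 < emeasure (M j) (E j) \<and> emeasure (M j) (E j) < \<infinity>) \<longleftrightarrow>
        (\<forall>j\<in>{1..d}. E j \<in> sets (N j) \<and> 0 < emeasure (N j) (E j) \<and> emeasure (N j) (E j) < top)" for E
      by (rule ball_cong[OF refl]) (simp only: N_def if_True infinity_ennreal_def)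
    show ?thesis
      unfolding rhs PiM_N sets_N
      by (subst Lp_norm_eq_iff[unfolded marg_def, OF pos[unfolded rhs] fin[unfolded rhs infinity_ennreal_def]])
        (intro iff_exI conj_cong refl AE_iff)
  qed
  show ?thesis
  proof (intro conjI allI impI)
    fix g :: "nat \<Rightarrow> (nat \<Rightarrow> 'a) \<Rightarrow> real"
    assume g: "\<forall>i\<in>{1..d}. g i \<in> borel_measurable (Pi\<^sub>M ({1..d} - {i}) M)
         \<and> (\<forall>y\<in>space (Pi\<^sub>M ({1..d} - {i}) M). g i y \<ge> 0)"
    show "(\<integral>\<^sup>+ x. ennreal (\<Prod>i\<in>{1..d}. g i (restrict x ({1..d} - {i}))) \<partial>(Pi\<^sub>M {1..d} M))
        \<le> (\<Prod>i\<in>{1..d}. Lp_norm (Pi\<^sub>M ({1..d} - {i}) M) (real d - 1) (\<lambda>y. ennreal (g i y)))"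
      unfolding PiM_N PiM_N' d1
      by (rule N.Loomis_Whitney[OF finite_atLeastAtMost card]) (use g[unfolded PiM_N'] in blast)+
  qed (elim conjE, (rule general special equality; assumption))+
qed

end
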